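(* Let $\vec A^{\pm}_{c_0,\alpha}\in\mathbb S^2$ be the limiting vectors defined in the context. The following statements hold: (i) For fixed $\alpha\in(0,1)$ there exists $c_0^\ast>0$ depending on $\alpha$ such that $\vec A^+_{c_0,\alpha}\ne\vec A^-_{c_0,\alpha}$ for all $c_0\in(0,c_0^\ast)$. (ii) For fixed $c_0>0$, there exists $\alpha_0^\ast>0$ small enough such that $\vec A^+_{c_0,\alpha}\ne\vec A^-_{c_0,\alpha}$ for all $\alpha\in(0,\alpha_0^\ast)$. (iii) For fixed $c_0>0$ with $c_0\ne k\sqrt\pi$ for all $k\in\mathbb N$, there exists $\alpha_1^\ast>0$ with $1-\alpha_1^\ast>0$ small enough such that $\vec A^+_{c_0,\alpha}\ne\vec A^-_{c_0,\alpha}$ for all $\alpha\in(\alpha_1^\ast,1)$.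
   Context: For $\alpha\in[0,1]$ put $\beta=\sqrt{1-\alpha^2}$. For $c_0>0$, $\{\vec m_{c_0,\alpha},\vec n_{c_0,\alpha},\vec b_{c_0,\alpha}\}$ denotes the unique global solution on $\mathbb R$ of the Serret--Frenet system $$\vec m'=c\,\vec n,\qquad \vec n'=-c\,\vec m+\tau\,\vec b,\qquad \vec b'=-\tau\,\vec n,$$ with $c(s)=c_0e^{-\alpha s^2/4}$, $\tau(s)=\beta s/2$ and $\vec m(0)=(1,0,0)$, $\vec n(0)=(0,1,0)$, $\vec b(0)=(0,0,1)$. The limiting vectors are $\vec A^{\pm}_{c_0,\alpha}:=\lim_{s\to\pm\infty}\vec m_{c_0,\alpha}(s)\in\mathbb S^2$ (these limits exist, and $\vec A^-_{c_0,\alpha}=(A^+_{1,c_0,\alpha},-A^+_{2,c_0,\alpha},-A^+_{3,c_0,\alpha})$). *)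

theory Defs
  imports "HOL-Analysis.Analysis"
begin

text \<open>Global solutions on the whole real line of the Serret--Frenet system with curvature \<open>c\<close> and
  torsion \<open>\<tau>\<close>, normalised to be the canonical frame at \<open>0\<close>.\<close>

definition serret_frenet ::
  "(real \<Rightarrow> real) \<Rightarrow> (real \<Rightarrow> real) \<Rightarrow> (real \<Rightarrow> real^3) \<Rightarrow> (real \<Rightarrow> real^3) \<Rightarrow> (real \<Rightarrow> real^3) \<Rightarrow> bool"
where
  "serret_frenet c \<tau> m n b \<longleftrightarrow>
     (\<forall>s. (m has_vector_derivative c s *\<^sub>R n s) (at s)) \<and>
     (\<forall>s. (n has_vector_derivative - (c s) *\<^sub>R m s + \<tau> s *\<^sub>R b s) (at s)) \<and>
     (\<forall>s. (b has_vector_derivative - (\<tau> s) *\<^sub>R n s) (at s)) \<and>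
     m 0 = vector [1, 0, 0] \<and> n 0 = vector [0, 1, 0] \<and> b 0 = vector [0, 0, 1]"

definition curvature :: "real \<Rightarrow> real \<Rightarrow> real \<Rightarrow> real" where
  "curvature c0 \<alpha> s = c0 * exp (- \<alpha> * s\<^sup>2 / 4)"

text \<open>The second parameter of the family is \<open>\<beta> = sqrt (1 - \<alpha>\<^sup>2)\<close>, which is meaningful only for
  \<open>\<alpha>\<close> in \<open>[0, 1]\<close>.\<close>

definition torsion :: "real \<Rightarrow> real \<Rightarrow> real" where
  "torsion \<alpha> s = sqrt (1 - \<alpha>\<^sup>2) * s / 2"

definition frame ::
  "real \<Rightarrow> real \<Rightarrow> (real \<Rightarrow> real^3) \<times> (real \<Rightarrow> real^3) \<times> (real \<Rightarrow> real^3)" where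
  "frame c0 \<alpha> = (THE (m, n, b). serret_frenet (curvature c0 \<alpha>) (torsion \<alpha>) m n b)"

definition tangent :: "real \<Rightarrow> real \<Rightarrow> real \<Rightarrow> real^3" where
  "tangent c0 \<alpha> = fst (frame c0 \<alpha>)"

text \<open>\<open>Lim\<close> and the definite description in \<open>frame\<close> are unspecified unless the limit, respectively
  the unique solution, exists; both do for \<open>c0 > 0\<close> and \<open>\<alpha>\<close> in \<open>[0, 1]\<close>.\<close>

definition A_plus :: "real \<Rightarrow> real \<Rightarrow> real^3" where
  "A_plus c0 \<alpha> = Lim at_top (tangent c0 \<alpha>)"

definition A_minus :: "real \<Rightarrow> real \<Rightarrow> real^3" where
  "A_minus c0 \<alpha> = Lim at_bot (tangent c0 \<alpha>)"

end

theory Submission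
  imports Defs "HOL-Probability.Distributions" "HOL-Real_Asymp.Real_Asymp"
begin

text \<open>Reflecting \<open>s\<close> to \<open>- s\<close> fixes the first coordinate of the tangent and negates the other two, so
  \<open>A_plus = A_minus\<close> holds exactly when \<open>A_plus\<close> lies on the first axis, that is, equals
  \<open>(\<sigma>, 0, 0)\<close> with \<open>\<bar>\<sigma>\<bar> = 1\<close>. All three parts assume this and derive a
  contradiction. The first coordinates \<open>x, y, z\<close> of the three frame vectors satisfy a scalar
  Serret--Frenet system and \<open>x\<^sup>2 + y\<^sup>2 + z\<^sup>2 = 1\<close>; hence \<open>x \<longlongrightarrow> \<sigma>\<close> forces \<open>y\<close> and \<open>z\<close> to tend
  to \<open>0\<close>. This situation is the locale \<open>axial_tangent\<close>, and each part has its own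
  quantitative consequence of it. Write \<open>\<phi> = \<beta> s\<^sup>2 / 4\<close> for the primitive of the torsion.

  For small \<open>c0\<close>: the combination \<open>y sin \<phi> + z cos \<phi>\<close> has derivative \<open>- c x sin \<phi>\<close>, in which
  the torsion no longer occurs. It starts at \<open>0\<close> and tends to \<open>0\<close>, while \<open>x = 1 + O(c0)\<close>. So the
  integral of \<open>exp (- \<alpha> s\<^sup>2 / 4) sin \<phi>\<close>, which is a positive constant depending on \<open>\<alpha>\<close> only
  (\<open>damped_sine_primitive_bounded_below\<close>), would be \<open>O(c0)\<close> (\<open>curvature_lower_bound\<close>).

  For \<open>\<alpha>\<close> near \<open>0\<close>: the curve \<open>G\<close> with tangent \<open>m\<close> and constant curvature \<open>c0\<close>, the case
  \<open>\<alpha> = 0\<close>, satisfies \<open>G - s m = 2 c0 b\<close> up to translation. In terms of the coordinates, \<open>s (1 - \<sigma> x) - 2 \<sigma> c0 z\<close>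
  is the primitive of \<open>1 - \<sigma> x \<ge> 0\<close>. For positive \<open>\<alpha>\<close> its analogue \<open>F\<close> acquires an error term in
  the derivative, whose integral is at most half that of \<open>1 - \<sigma> x\<close> plus \<open>O(sqrt \<alpha>)\<close>. If the
  tangent becomes axial then \<open>F\<close> tends to \<open>0\<close>, so the integral of \<open>1 - \<sigma> x\<close> is \<open>O(sqrt \<alpha>)\<close>;
  but near \<open>s = 0\<close> the curve bends by an amount bounded below in terms of \<open>c0\<close>
  (\<open>damping_lower_bound\<close>). No limit \<open>\<alpha> \<longlongrightarrow> 0\<close> of \<open>A_plus\<close> has to be computed.

  For \<open>\<alpha>\<close> near \<open>1\<close>: the torsion is small, and the tangent is close to the planar one, which turns
  by the total angle \<open>c0 sqrt (\<pi> / \<alpha>)\<close>. An axial limit therefore forces the sine of this angle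
  to be \<open>O(\<beta>)\<close> (\<open>sin_total_curvature_bound\<close>), whereas it tends to \<open>sin (c0 sqrt \<pi>)\<close>, which is not
  \<open>0\<close> unless \<open>c0\<close> is a multiple of \<open>sqrt \<pi>\<close>.

  The frame and the limits are given by description operators, so existence and uniqueness of the
  solution (\<open>tangent_serret_frenet\<close>) and convergence of the tangent (\<open>tangent_tendsto\<close>) have to
  come before all this.\<close>

section \<open>Linear differential equations on the whole line\<close>

text \<open>This is the induction step for the factorial bounds on the Picard iterates. Both signs of \<open>r\<close> are
  treated at once by running along the ray from \<open>0\<close> through \<open>r\<close>.\<close>

lemma norm_le_power_if_derivative_norm_le_power:
  fixes f :: "real \<Rightarrow> 'a::real_normed_vector"
  assumes f: "\<And>s. (f has_vector_derivative f' s) (at s)" and f0: "f 0 = 0"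
    and bd: "\<And>s. \<bar>s\<bar> \<le> \<bar>r\<bar> \<Longrightarrow> norm (f' s) \<le> K * \<bar>s\<bar> ^ n"
  shows "norm (f r) \<le> K * \<bar>r\<bar> ^ Suc n / real (Suc n)"
proof (cases "r = 0")
  case True
  then show ?thesis using f0 by simp
next
  case False
  have *: "((\<lambda>t. f (sgn r * t)) has_vector_derivative sgn r *\<^sub>R f' (sgn r * t)) (at t)" for t
  proof -
    have "((\<lambda>t. sgn r * t) has_vector_derivative sgn r) (at t)"
      unfolding has_real_derivative_iff_has_vector_derivative[symmetric]
      by (auto intro!: derivative_eq_intros)
    from vector_diff_chain_at[OF this f] show ?thesis by (simp add: o_def)
  qed
  have cont: "continuous_on {0..\<bar>r\<bar>} (\<lambda>t. f (sgn r * t))"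
    using * by (intro continuous_at_imp_continuous_on) (auto intro: has_vector_derivative_continuous)
  have deriv: "((\<lambda>t. K * t ^ Suc n / real (Suc n)) has_vector_derivative K * t ^ n) (at t)" for t
    unfolding has_real_derivative_iff_has_vector_derivative[symmetric]
    by (rule derivative_eq_intros refl | simp)+
  have "norm (f (sgn r * \<bar>r\<bar>) - f (sgn r * 0)) \<le> K * \<bar>r\<bar> ^ Suc n / real (Suc n) - K * 0 ^ Suc n / real (Suc n)"
  proof (rule differentiable_bound_general[OF _ cont _ * deriv])
    show "0 < \<bar>r\<bar>" using False by simp
    show "continuous_on {0..\<bar>r\<bar>} (\<lambda>t. K * t ^ Suc n / real (Suc n))"
      by (intro continuous_intros) auto
    fix t assume "0 < t" "t < \<bar>r\<bar>"
    then show "norm (sgn r *\<^sub>R f' (sgn r * t)) \<le> K * t ^ n"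
      using bd[of "sgn r * t"] False by (auto simp: abs_mult)
  qed
  then show ?thesis using f0 by (simp add: sgn_mult_abs)
qed

lemma continuous_has_antiderivative:
  fixes g :: "real \<Rightarrow> 'a::euclidean_space"
  assumes "continuous_on UNIV g"
  shows "\<exists>G. G 0 = 0 \<and> (\<forall>s. (G has_vector_derivative g s) (at s))"
proof -
  have "\<exists>G. \<forall>s. (G has_vector_derivative g s) (at s)"
    using einterval_antiderivative[of "-\<infinity>" \<infinity> g] assms
    by (simp add: continuous_on_eq_continuous_at)
  then obtain G where "\<And>s. (G has_vector_derivative g s) (at s)" by blast
  then have "((\<lambda>s. G s - G 0) has_vector_derivative g s) (at s)" for s
    by (auto intro!: derivative_eq_intros)
  then show ?thesis by (intro exI[of _ "\<lambda>s. G s - G 0"]) simp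
qed

text \<open>The solution is the sum of the Picard iterates \<open>u n\<close>, where \<open>u (Suc n)\<close> is the primitive of
  \<open>A s (u n s)\<close>. On \<open>\<bar>s\<bar> \<le> R\<close> with \<open>norm (A s) \<le> L\<close> the iterates are bounded by
  \<open>norm x0 * (L R)^n / n!\<close>, so the series of derivatives converges uniformly there and may be summed
  termwise; as \<open>R\<close> is arbitrary the solution is global.\<close>

theorem linear_ode_global_solution:
  fixes A :: "real \<Rightarrow> 'a::euclidean_space \<Rightarrow>\<^sub>L 'a"
  assumes A: "continuous_on UNIV A"
  shows "\<exists>x. x 0 = x0 \<and> (\<forall>s. (x has_vector_derivative A s (x s)) (at s))"
proof -
  define prim where "prim g G \<longleftrightarrow> G 0 = 0 \<and> (\<forall>s. (G has_vector_derivative g s) (at s))"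
    for g G :: "real \<Rightarrow> 'a"
  have prim_ex: "\<exists>G. prim g G" if "continuous_on UNIV g" for g
    unfolding prim_def by (rule continuous_has_antiderivative[OF that])
  define u where "u = rec_nat (\<lambda>_. x0) (\<lambda>_ g. SOME G. prim (\<lambda>s. A s (g s)) G)"
  have u0: "u 0 = (\<lambda>_. x0)" by (simp add: u_def)
  have uSuc: "u (Suc n) = (SOME G. prim (\<lambda>s. A s (u n s)) G)" for n by (simp add: u_def)
  have vd_cont: "continuous_on UNIV G" if "prim g G" for g G
    using that unfolding prim_def
    by (intro continuous_at_imp_continuous_on) (auto intro: has_vector_derivative_continuous)
  have ucont: "continuous_on UNIV (u n)" for n
  proof (induction n)
    case 0 show ?case by (simp add: u0)
  next
    case (Suc n)
    have "continuous_on UNIV (\<lambda>s. A s (u n s))"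
      using A Suc by (intro continuous_intros)
    then show ?case unfolding uSuc using someI_ex[OF prim_ex] vd_cont by blast
  qed
  have uprim: "prim (\<lambda>s. A s (u n s)) (u (Suc n))" for n
  proof -
    have "continuous_on UNIV (\<lambda>s. A s (u n s))"
      using A ucont by (intro continuous_intros)
    then show ?thesis unfolding uSuc using someI_ex[OF prim_ex] by blast
  qed
  \<comment> \<open>The derivative of \<open>u n\<close>; the shift in the index makes the sum of the \<open>v n\<close> equal to \<open>A\<close> applied to the sum of the \<open>u n\<close>.\<close>
  define v where "v n s = (case n of 0 \<Rightarrow> 0 | Suc k \<Rightarrow> A s (u k s))" for n s
  have uv: "(u n has_vector_derivative v n s) (at s)" for n s
    using uprim by (cases n) (auto simp: v_def u0 prim_def)
  define x where "x s = (\<Sum>n. u n s)" for s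
  have main: "(x has_vector_derivative A s (x s)) (at s) \<and> summable (\<lambda>n. u n s)" for s
  proof -
    define R where "R = \<bar>s\<bar> + 1"
    have R: "\<bar>s\<bar> < R" "0 < R" by (auto simp: R_def)
    have "compact ((\<lambda>t. norm (A t)) ` {-R..R})"
      by (intro compact_continuous_image continuous_on_norm continuous_on_subset[OF A]) auto
    then obtain L where L: "\<And>t. \<bar>t\<bar> \<le> R \<Longrightarrow> norm (A t) \<le> L"
      using compact_imp_bounded[THEN bounded_real[THEN iffD1]] by (fastforce simp: abs_le_iff)
    have L0: "0 \<le> L" using L[of 0] R norm_ge_zero[of "A 0"] by linarith
    have ub: "norm (u n t) \<le> norm x0 * L ^ n / fact n * \<bar>t\<bar> ^ n" if "\<bar>t\<bar> \<le> R" for n t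
      using that
    proof (induction n arbitrary: t)
      case 0 then show ?case by (simp add: u0)
    next
      case (Suc n)
      have "norm (u (Suc n) t) \<le> (L * (norm x0 * L ^ n / fact n)) * \<bar>t\<bar> ^ Suc n / real (Suc n)"
      proof (rule norm_le_power_if_derivative_norm_le_power[where f' = "\<lambda>s. A s (u n s)"])
        fix r assume r: "\<bar>r\<bar> \<le> \<bar>t\<bar>"
        have "norm (A r (u n r)) \<le> norm (A r) * norm (u n r)" by (rule norm_blinfun)
        also have "\<dots> \<le> L * (norm x0 * L ^ n / fact n * \<bar>r\<bar> ^ n)"
          using r Suc L L0 by (intro mult_mono) auto
        finally show "norm (A r (u n r)) \<le> L * (norm x0 * L ^ n / fact n) * \<bar>r\<bar> ^ n"
          by (simp add: mult.assoc)
      qed (use uprim[of n] in \<open>auto simp: prim_def\<close>)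
      then show ?case by (simp add: field_simps)
    qed
    define M where "M n = norm x0 * L ^ n / fact n * R ^ n" for n
    have sumM: "summable M"
      using summable_mult[OF summable_exp[of "L * R"], of "norm x0"]
      by (simp add: M_def[abs_def] field_simps power_mult_distrib)
    have uM: "norm (u n t) \<le> M n" if "\<bar>t\<bar> < R" for n t
    proof -
      have "norm x0 * L ^ n / fact n * \<bar>t\<bar> ^ n \<le> M n"
        unfolding M_def using that L0 by (intro mult_left_mono power_mono) auto
      then show ?thesis using ub[of t n] that by linarith
    qed
    have summ: "summable (\<lambda>n. u n t)" if "\<bar>t\<bar> < R" for t
      using uM[OF that] sumM by (rule summable_comparison_test'[rotated, where N = 0])
    define N where "N n = (case n of 0 \<Rightarrow> 0 | Suc k \<Rightarrow> L * M k)" for n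
    have sumN: "summable N"
      using summable_mult[OF sumM, of L] by (subst summable_Suc_iff[symmetric]) (simp add: N_def)
    have vN: "norm (v n t) \<le> N n" if "\<bar>t\<bar> < R" for n t
    proof (cases n)
      case (Suc k)
      have "norm (A t (u k t)) \<le> norm (A t) * norm (u k t)" by (rule norm_blinfun)
      also have "\<dots> \<le> L * M k" using that L uM L0 by (intro mult_mono) auto
      finally show ?thesis by (simp add: Suc v_def N_def)
    qed (simp add: v_def N_def)
    have sumv: "(\<Sum>n. v n t) = A t (x t)" if "\<bar>t\<bar> < R" for t
    proof -
      have "summable (\<lambda>n. v n t)"
        using vN[OF that] sumN by (rule summable_comparison_test'[rotated, where N = 0])
      then have "(\<Sum>n. v n t) = (\<Sum>n. v (Suc n) t)"
        by (subst suminf_split_head) (simp_all add: v_def)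
      also have "\<dots> = A t (x t)"
        using bounded_linear.suminf[OF blinfun.bounded_linear_right[of "A t"] summ[OF that]]
        by (simp add: v_def x_def)
      finally show ?thesis .
    qed
    have unif: "uniform_limit {-R<..<R} (\<lambda>n t. \<Sum>i<n. v i t) (\<lambda>t. \<Sum>n. v n t) sequentially"
      by (rule Weierstrass_m_test[OF _ sumN]) (use vN in auto)
    have "\<exists>g. \<forall>t\<in>{-R<..<R}. (\<lambda>n. u n t) sums g t \<and>
        (g has_derivative (\<lambda>h. h *\<^sub>R (\<Sum>n. v n t))) (at t within {-R<..<R})"
    proof (rule has_derivative_series)
      show "(u n has_derivative (\<lambda>h. h *\<^sub>R v n t)) (at t within {-R<..<R})" for n t
        using uv[of n t] has_derivative_at_withinI unfolding has_vector_derivative_def by blast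
      show "(\<lambda>n. u n s) sums x s" using summ[of s] R by (simp add: x_def summable_sums)
      show "s \<in> {-R<..<R}" using R by auto
      fix e :: real assume "0 < e"
      from uniform_limitD[OF unif this]
      show "\<forall>\<^sub>F n in sequentially. \<forall>t\<in>{-R<..<R}. \<forall>h.
          norm ((\<Sum>i<n. h *\<^sub>R v i t) - h *\<^sub>R (\<Sum>n. v n t)) \<le> e * norm h"
      proof eventually_elim
        case (elim n)
        have "norm ((\<Sum>i<n. h *\<^sub>R v i t) - h *\<^sub>R (\<Sum>n. v n t)) \<le> e * norm h" if t: "t \<in> {-R<..<R}" for t h
        proof -
          have "(\<Sum>i<n. h *\<^sub>R v i t) - h *\<^sub>R (\<Sum>n. v n t) = h *\<^sub>R ((\<Sum>i<n. v i t) - (\<Sum>n. v n t))"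
            by (simp add: scaleR_right.sum scaleR_diff_right)
          moreover have "norm ((\<Sum>i<n. v i t) - (\<Sum>n. v n t)) \<le> e"
            using elim t by (force simp: dist_norm)
          ultimately show ?thesis
            by (metis abs_ge_zero mult.commute mult_left_mono norm_scaleR real_norm_def)
        qed
        then show ?case by blast
      qed
    qed simp
    then obtain g where g: "\<And>t. t \<in> {-R<..<R} \<Longrightarrow> (\<lambda>n. u n t) sums g t"
      "\<And>t. t \<in> {-R<..<R} \<Longrightarrow> (g has_derivative (\<lambda>h. h *\<^sub>R (\<Sum>n. v n t))) (at t within {-R<..<R})"
      by blast
    have gx: "g t = x t" if "t \<in> {-R<..<R}" for t
      using g(1)[OF that] by (simp add: x_def sums_iff)
    have s: "s \<in> {-R<..<R}" using R by auto
    have "(g has_derivative (\<lambda>h. h *\<^sub>R A s (x s))) (at s)"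
      using g(2)[OF s] sumv R s by (simp add: at_within_open[OF s])
    then have "(x has_derivative (\<lambda>h. h *\<^sub>R A s (x s))) (at s)"
      using gx s by (auto intro: has_derivative_transform_within_open[of g _ s UNIV "{-R<..<R}"])
    then show ?thesis using summ[OF R(1)] by (simp add: has_vector_derivative_def)
  qed
  have "u (Suc n) 0 = 0" for n using uprim[of n] by (simp add: prim_def)
  then have "x 0 = x0"
    using suminf_split_head[of "\<lambda>n. u n 0"] main[of 0] by (simp add: x_def u0)
  then show ?thesis using main by blast
qed

section \<open>Comparison of derivatives, and the Gaussian primitive\<close>

text \<open>Integral estimates over half-lines are phrased below as comparisons of derivatives, so that only
  limits of explicit functions are needed and no improper integrals.\<close>

lemma diff_le_if_derivative_le:
  fixes f g :: "real \<Rightarrow> real"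
  assumes "a \<le> b"
    and f: "\<And>s. a \<le> s \<Longrightarrow> s \<le> b \<Longrightarrow> (f has_real_derivative f' s) (at s)"
    and g: "\<And>s. a \<le> s \<Longrightarrow> s \<le> b \<Longrightarrow> (g has_real_derivative g' s) (at s)"
    and le: "\<And>s. a \<le> s \<Longrightarrow> s \<le> b \<Longrightarrow> f' s \<le> g' s"
  shows "f b - f a \<le> g b - g a"
proof -
  have "g a - f a \<le> g b - f b"
  proof (rule DERIV_nonneg_imp_nondecreasing[OF \<open>a \<le> b\<close>])
    fix s assume "a \<le> s" "s \<le> b"
    then show "\<exists>d. ((\<lambda>s. g s - f s) has_real_derivative d) (at s) \<and> 0 \<le> d"
      using DERIV_diff[OF g[of s] f[of s]] le[of s] by force
  qed
  then show ?thesis by simp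
qed

lemma mono_if_derivative_nonneg:
  fixes f :: "real \<Rightarrow> real"
  assumes "\<And>s. (f has_real_derivative f' s) (at s)" "\<And>s. 0 \<le> f' s"
  shows "mono f"
  using diff_le_if_derivative_le[of _ _ "\<lambda>_. 0" "\<lambda>_. 0" f f'] assms by (auto intro!: monoI)

lemma gaussian_primitive:
  fixes k :: real
  assumes k: "0 < k"
  obtains \<theta> where "\<theta> 0 = 0" "\<And>s. (\<theta> has_real_derivative exp (- k * s\<^sup>2)) (at s)"
    "(\<theta> \<longlongrightarrow> sqrt (pi / k) / 2) at_top"
proof -
  have "continuous_on UNIV (\<lambda>s::real. exp (- s\<^sup>2))" by (intro continuous_intros)
  then obtain G :: "real \<Rightarrow> real" where G0: "G 0 = 0" and G: "\<And>s. (G has_real_derivative exp (- s\<^sup>2)) (at s)"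
    using continuous_has_antiderivative unfolding has_real_derivative_iff_has_vector_derivative by blast
  have "((\<lambda>u. \<integral>x. indicator {..u::real} x *\<^sub>R (indicator {0..} x *\<^sub>R exp (- x\<^sup>2)) \<partial>lborel)
      \<longlongrightarrow> (\<integral>x. indicator {0..} x *\<^sub>R exp (- x\<^sup>2) \<partial>lborel)) at_top"
    by (rule tendsto_integral_at_top) (use gaussian_moment_0 in \<open>auto simp: has_bochner_integral_iff\<close>)
  moreover have "(\<integral>x. indicator {..u} x *\<^sub>R (indicator {0..} x *\<^sub>R exp (- x\<^sup>2)) \<partial>lborel) = G u"
    if "0 \<le> u" for u
  proof -
    have "(\<integral>x. indicator {0..u} x *\<^sub>R exp (- x\<^sup>2) \<partial>lborel) = G u - G 0"
      by (rule integral_FTC_Icc[OF that])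
        (auto intro!: continuous_intros has_vector_derivative_at_within G[unfolded has_real_derivative_iff_has_vector_derivative])
    moreover have "(\<lambda>x. indicator {..u} x *\<^sub>R (indicator {0..} x *\<^sub>R exp (- x\<^sup>2)))
        = (\<lambda>x. indicator {0..u} x *\<^sub>R exp (- x\<^sup>2) :: real)"
      by (auto simp: indicator_def)
    ultimately show ?thesis using G0 by simp
  qed
  ultimately have "((\<lambda>u. G u) \<longlongrightarrow> (\<integral>x. indicator {0..} x *\<^sub>R exp (- x\<^sup>2) \<partial>lborel)) at_top"
    by (elim Lim_transform_eventually) (auto intro!: eventually_mono[OF eventually_ge_at_top[of 0]])
  then have lim: "((\<lambda>u. G u) \<longlongrightarrow> sqrt pi / 2) at_top"
    unfolding has_bochner_integral_integral_eq[OF gaussian_moment_0] .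
  show thesis
  proof
    show "((\<lambda>s. G (sqrt k * s) / sqrt k) has_real_derivative exp (- k * s\<^sup>2)) (at s)" for s
    proof -
      have "((\<lambda>s. G (sqrt k * s)) has_real_derivative exp (- (sqrt k * s)\<^sup>2) * sqrt k) (at s)"
        by (rule DERIV_chain2[OF G]) (auto intro!: derivative_eq_intros)
      from DERIV_cdivide[OF this, of "sqrt k"]
      show ?thesis using k by (simp add: power_mult_distrib)
    qed
    have "filterlim (\<lambda>s. sqrt k * s) at_top at_top"
      using k by (intro filterlim_tendsto_pos_mult_at_top[OF tendsto_const] filterlim_ident) auto
    from tendsto_divide[OF filterlim_compose[OF lim this] tendsto_const[of "sqrt k"]]
    show "((\<lambda>s. G (sqrt k * s) / sqrt k) \<longlongrightarrow> sqrt (pi / k) / 2) at_top"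
      using k by (simp add: real_sqrt_divide mult.commute)
  qed (simp add: G0)
qed

lemma mono_bounded_tendsto_at_top:
  fixes f :: "real \<Rightarrow> real"
  assumes mono: "mono f" and bd: "\<And>s. f s \<le> B"
  shows "\<exists>l. (f \<longlongrightarrow> l) at_top"
proof -
  have bdd: "bdd_above (range f)" using bd by (auto simp: bdd_above_def)
  have "(f \<longlongrightarrow> (SUP s. f s)) at_top"
  proof (rule increasing_tendsto)
    show "\<forall>\<^sub>F s in at_top. f s \<le> (SUP s. f s)"
      using bdd by (auto intro!: always_eventually cSUP_upper)
    fix a assume "a < (SUP s. f s)"
    then obtain r where "a < f r" using less_cSUP_iff[OF _ bdd] by auto
    then have "a < f s" if "r \<le> s" for s using monoD[OF mono that] by linarith
    then show "\<forall>\<^sub>F s in at_top. a < f s"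
      by (rule eventually_mono[OF eventually_ge_at_top[of r]])
  qed
  then show ?thesis by blast
qed

section \<open>The Serret--Frenet system coordinate by coordinate\<close>

text \<open>The system satisfied by the \<open>j\<close>-th coordinates of the three frame vectors, for each fixed \<open>j\<close>.\<close>

definition frenet_row :: "(real \<Rightarrow> real) \<Rightarrow> (real \<Rightarrow> real) \<Rightarrow> (real \<Rightarrow> real) \<Rightarrow> (real \<Rightarrow> real) \<Rightarrow> (real \<Rightarrow> real) \<Rightarrow> bool"
  where "frenet_row c \<tau> x y z \<longleftrightarrow>
     (\<forall>s. (x has_real_derivative c s * y s) (at s)) \<and>
     (\<forall>s. (y has_real_derivative - c s * x s + \<tau> s * z s) (at s)) \<and>
     (\<forall>s. (z has_real_derivative - \<tau> s * y s) (at s))"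

lemma frenet_rowD:
  assumes "frenet_row c \<tau> x y z"
  shows "(x has_real_derivative c s * y s) (at s)"
    and "(y has_real_derivative - c s * x s + \<tau> s * z s) (at s)"
    and "(z has_real_derivative - \<tau> s * y s) (at s)"
  using assms unfolding frenet_row_def by blast+

text \<open>The coefficient matrix is antisymmetric. This single conservation law gives uniqueness (apply it
  to the difference of two solutions with itself) and orthonormality of the frame (apply it to two
  coordinates).\<close>

lemma frenet_row_dot_constant:
  assumes "frenet_row c \<tau> x y z" "frenet_row c \<tau> x' y' z'"
  shows "x s * x' s + y s * y' s + z s * z' s = x 0 * x' 0 + y 0 * y' 0 + z 0 * z' 0"
proof -
  note D = frenet_rowD[OF assms(1)] frenet_rowD[OF assms(2)]
  have "((\<lambda>s. x s * x' s + y s * y' s + z s * z' s) has_real_derivative 0) (at s)" for s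
    by (rule derivative_eq_intros D refl)+ (simp add: algebra_simps)
  then show ?thesis
    by (rule DERIV_isconst_all[of "\<lambda>s. x s * x' s + y s * y' s + z s * z' s" s 0, OF allI])
qed

lemma frenet_row_diff:
  assumes "frenet_row c \<tau> x y z" "frenet_row c \<tau> x' y' z'"
  shows "frenet_row c \<tau> (\<lambda>s. x s - x' s) (\<lambda>s. y s - y' s) (\<lambda>s. z s - z' s)"
  unfolding frenet_row_def
  using DERIV_diff[OF frenet_rowD(1)[OF assms(1)] frenet_rowD(1)[OF assms(2)]]
    DERIV_diff[OF frenet_rowD(2)[OF assms(1)] frenet_rowD(2)[OF assms(2)]]
    DERIV_diff[OF frenet_rowD(3)[OF assms(1)] frenet_rowD(3)[OF assms(2)]]
  by (simp add: algebra_simps)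

lemma frenet_row_unique:
  assumes "frenet_row c \<tau> x y z" "frenet_row c \<tau> x' y' z'" "x 0 = x' 0" "y 0 = y' 0" "z 0 = z' 0"
  shows "x s = x' s" "y s = y' s" "z s = z' s"
proof -
  let ?x = "x s - x' s" and ?y = "y s - y' s" and ?z = "z s - z' s"
  note d = frenet_row_diff[OF assms(1,2)]
  have "?x\<^sup>2 + ?y\<^sup>2 + ?z\<^sup>2 = 0"
    using frenet_row_dot_constant[OF d d, of s] assms(3-5) by (simp add: power2_eq_square)
  then have "?x = 0 \<and> ?y = 0 \<and> ?z = 0"
    by (simp add: add_nonneg_eq_0_iff)
  then show "x s = x' s" "y s = y' s" "z s = z' s" by auto
qed

lemma serret_frenet_iff_rows:
  "serret_frenet c \<tau> m n b \<longleftrightarrow>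
     (\<forall>j. frenet_row c \<tau> (\<lambda>s. m s $ j) (\<lambda>s. n s $ j) (\<lambda>s. b s $ j)) \<and>
     m 0 = vector [1, 0, 0] \<and> n 0 = vector [0, 1, 0] \<and> b 0 = vector [0, 0, 1]"
proof -
  have vec: "(f has_vector_derivative f') (at s) \<longleftrightarrow>
      (\<forall>j. ((\<lambda>s. f s $ j) has_real_derivative f' $ j) (at s))" for f :: "real \<Rightarrow> real^3" and f' s
    unfolding has_real_derivative_iff_has_vector_derivative has_vector_derivative_def
    by (subst has_derivative_componentwise_within)
      (auto simp: Basis_vec_def inner_axis)
  show ?thesis
    unfolding serret_frenet_def frenet_row_def vec
      vector_add_component vector_scaleR_component real_scaleR_def
    by blast
qed

lemma serret_frenet_unique:
  assumes "serret_frenet c \<tau> m n b" "serret_frenet c \<tau> m' n' b'"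
  shows "m = m'" "n = n'" "b = b'"
proof -
  have row: "frenet_row c \<tau> (\<lambda>s. m s $ j) (\<lambda>s. n s $ j) (\<lambda>s. b s $ j)"
    "frenet_row c \<tau> (\<lambda>s. m' s $ j) (\<lambda>s. n' s $ j) (\<lambda>s. b' s $ j)" for j
    using assms unfolding serret_frenet_iff_rows by blast+
  have ini: "m 0 $ j = m' 0 $ j" "n 0 $ j = n' 0 $ j" "b 0 $ j = b' 0 $ j" for j
    using assms unfolding serret_frenet_def by simp_all
  note unique = frenet_row_unique[OF row ini]
  show "m = m'" "n = n'" "b = b'"
    by (simp_all add: fun_eq_iff vec_eq_iff unique)
qed

lemma serret_frenet_exists:
  assumes c: "continuous_on UNIV c" and \<tau>: "continuous_on UNIV \<tau>"
  shows "\<exists>m n b. serret_frenet c \<tau> m n b"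
proof -
  define C :: "((real^3) \<times> (real^3) \<times> (real^3)) \<Rightarrow>\<^sub>L ((real^3) \<times> (real^3) \<times> (real^3))"
    where "C = Blinfun (\<lambda>(m, n, b). (n, - m, 0))"
  define T :: "((real^3) \<times> (real^3) \<times> (real^3)) \<Rightarrow>\<^sub>L ((real^3) \<times> (real^3) \<times> (real^3))"
    where "T = Blinfun (\<lambda>(m, n, b). (0, b, - n))"
  have C: "C (m, n, b) = (n, - m, 0)" for m n b
  proof -
    have "bounded_linear (\<lambda>(m :: real^3, n :: real^3, b :: real^3). (n, - m, 0 :: real^3))"
      unfolding linear_conv_bounded_linear[symmetric] by (rule linearI) auto
    then show ?thesis unfolding C_def by (subst bounded_linear_Blinfun_apply) auto
  qed
  have T: "T (m, n, b) = (0, b, - n)" for m n b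
  proof -
    have "bounded_linear (\<lambda>(m :: real^3, n :: real^3, b :: real^3). (0 :: real^3, b, - n))"
      unfolding linear_conv_bounded_linear[symmetric] by (rule linearI) auto
    then show ?thesis unfolding T_def by (subst bounded_linear_Blinfun_apply) auto
  qed
  have "continuous_on UNIV (\<lambda>s. c s *\<^sub>R C + \<tau> s *\<^sub>R T)"
    using c \<tau> by (intro continuous_intros)
  from linear_ode_global_solution[OF this,
      of "(vector [1, 0, 0], vector [0, 1, 0], vector [0, 0, 1])"]
  obtain X where X0: "X 0 = (vector [1, 0, 0], vector [0, 1, 0], vector [0, 0, 1])"
    and X: "\<And>s. (X has_vector_derivative (c s *\<^sub>R C + \<tau> s *\<^sub>R T) (X s)) (at s)"
    by blast
  define m n b where "m s = fst (X s)" and "n s = fst (snd (X s))" and "b s = snd (snd (X s))" for s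
  have split: "X s = (m s, n s, b s)" for s by (simp add: m_def n_def b_def)
  have X': "(X has_vector_derivative (c s *\<^sub>R n s, - (c s) *\<^sub>R m s + \<tau> s *\<^sub>R b s, - (\<tau> s) *\<^sub>R n s)) (at s)" for s
    using X[of s] by (simp add: blinfun.add_left blinfun.scaleR_left split C T)
  have "serret_frenet c \<tau> m n b"
    unfolding serret_frenet_def
  proof (intro conjI allI)
    fix s
    show "(m has_vector_derivative c s *\<^sub>R n s) (at s)"
      using bounded_linear.has_vector_derivative[OF bounded_linear_fst X'[of s]]
      by (simp add: m_def[abs_def])
    note X2 = bounded_linear.has_vector_derivative[OF bounded_linear_snd X'[of s]]
    show "(n has_vector_derivative - (c s) *\<^sub>R m s + \<tau> s *\<^sub>R b s) (at s)"
      using bounded_linear.has_vector_derivative[OF bounded_linear_fst X2]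
      by (simp add: n_def[abs_def])
    show "(b has_vector_derivative - (\<tau> s) *\<^sub>R n s) (at s)"
      using bounded_linear.has_vector_derivative[OF bounded_linear_snd X2]
      by (simp add: b_def[abs_def])
  qed (simp_all add: m_def n_def b_def X0)
  then show ?thesis by blast
qed

lemma tangent_serret_frenet:
  obtains n b where "serret_frenet (curvature c0 \<alpha>) (torsion \<alpha>) (tangent c0 \<alpha>) n b"
proof -
  let ?P = "\<lambda>(m, n, b). serret_frenet (curvature c0 \<alpha>) (torsion \<alpha>) m n b"
  have "continuous_on UNIV (curvature c0 \<alpha>)" "continuous_on UNIV (torsion \<alpha>)"
    unfolding curvature_def[abs_def] torsion_def[abs_def] by (intro continuous_intros; simp)+
  note ex = serret_frenet_exists[OF this]
  have "\<exists>!p. ?P p"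
  proof (rule ex_ex1I)
    show "\<exists>p. ?P p" using ex by auto
    show "p = q" if "?P p" "?P q" for p q
    proof -
      obtain m n b m' n' b' where "p = (m, n, b)" "q = (m', n', b')"
        by (cases p, cases q) blast
      then show ?thesis using that serret_frenet_unique[of _ _ m n b m' n' b'] by simp
    qed
  qed
  from theI'[OF this] have "?P (frame c0 \<alpha>)" by (simp add: frame_def)
  then show thesis using that by (auto simp: tangent_def split: prod.splits)
qed

lemma frenet_row_reflect:
  assumes row: "frenet_row c \<tau> x y z" and c: "\<And>s. c (- s) = c s" and \<tau>: "\<And>s. \<tau> (- s) = - \<tau> s"
  shows "frenet_row c \<tau> (\<lambda>s. x (- s)) (\<lambda>s. - y (- s)) (\<lambda>s. - z (- s))"
proof -
  have "((\<lambda>s. f (- s)) has_real_derivative - f' (- s)) (at s)"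
    if "\<And>s. (f has_real_derivative f' s) (at s)" for f f' :: "real \<Rightarrow> real" and s
  proof -
    have "((\<lambda>s. - s) has_real_derivative - 1) (at s)" by (auto intro!: derivative_eq_intros)
    from DERIV_chain2[of f "f' (- s)" "\<lambda>s. - s" s "- 1" UNIV, OF that this] show ?thesis by simp
  qed
  note r = this[where f = x, OF frenet_rowD(1)[OF row]] this[where f = y, OF frenet_rowD(2)[OF row]]
    this[where f = z, OF frenet_rowD(3)[OF row]]
  show ?thesis
    unfolding frenet_row_def using r(1) DERIV_minus[OF r(2)] DERIV_minus[OF r(3)]
    by (simp add: c \<tau> algebra_simps)
qed

lemma frenet_row_neg:
  assumes "frenet_row c \<tau> x y z"
  shows "frenet_row c \<tau> (\<lambda>s. - x s) (\<lambda>s. - y s) (\<lambda>s. - z s)"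
  unfolding frenet_row_def
  using frenet_rowD[OF assms, THEN DERIV_minus] by (simp add: algebra_simps)

text \<open>The reflected first row, and the reflected and negated second and third rows, solve the same
  system with the same initial values.\<close>

lemma tangent_reflect:
  "tangent c0 \<alpha> (- s) $ 1 = tangent c0 \<alpha> s $ 1"
  "tangent c0 \<alpha> (- s) $ 2 = - tangent c0 \<alpha> s $ 2"
  "tangent c0 \<alpha> (- s) $ 3 = - tangent c0 \<alpha> s $ 3"
proof -
  obtain n b where sf: "serret_frenet (curvature c0 \<alpha>) (torsion \<alpha>) (tangent c0 \<alpha>) n b"
    by (rule tangent_serret_frenet)
  define m where "m = tangent c0 \<alpha>"
  note sf = sf[folded m_def, unfolded serret_frenet_iff_rows]
  have row: "frenet_row (curvature c0 \<alpha>) (torsion \<alpha>) (\<lambda>s. m s $ j) (\<lambda>s. n s $ j) (\<lambda>s. b s $ j)" for j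
    using sf by blast
  have ini: "m 0 = vector [1, 0, 0]" "n 0 = vector [0, 1, 0]" "b 0 = vector [0, 0, 1]"
    using sf by auto
  have refl: "frenet_row (curvature c0 \<alpha>) (torsion \<alpha>) (\<lambda>s. m (- s) $ j) (\<lambda>s. - n (- s) $ j) (\<lambda>s. - b (- s) $ j)" for j
    by (rule frenet_row_reflect[OF row]) (auto simp: curvature_def torsion_def)
  show "tangent c0 \<alpha> (- s) $ 1 = tangent c0 \<alpha> s $ 1"
    using frenet_row_unique(1)[OF refl[of 1] row[of 1], of s] by (simp add: ini m_def[symmetric])
  show "tangent c0 \<alpha> (- s) $ 2 = - tangent c0 \<alpha> s $ 2"
    using frenet_row_unique(1)[OF refl[of 2] frenet_row_neg[OF row[of 2]], of s]
    by (simp add: ini m_def[symmetric])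
  show "tangent c0 \<alpha> (- s) $ 3 = - tangent c0 \<alpha> s $ 3"
    using frenet_row_unique(1)[OF refl[of 3] frenet_row_neg[OF row[of 3]], of s]
    by (simp add: ini m_def[symmetric])
qed

text \<open>The conserved products say that the matrix with rows \<open>m, n, b\<close> has orthonormal columns. Then its
  rows are orthonormal too, since a one-sided inverse of a square matrix is two-sided.\<close>

lemma serret_frenet_norm_tangent:
  assumes "serret_frenet c \<tau> m n b"
  shows "norm (m s) = 1"
proof -
  have row: "frenet_row c \<tau> (\<lambda>s. m s $ j) (\<lambda>s. n s $ j) (\<lambda>s. b s $ j)" for j
    using assms unfolding serret_frenet_iff_rows by blast
  have ini: "m 0 = vector [1, 0, 0]" "n 0 = vector [0, 1, 0]" "b 0 = vector [0, 0, 1]"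
    using assms unfolding serret_frenet_iff_rows by auto
  define X :: "real^3^3" where "X = vector [m s, n s, b s]"
  have "transpose X ** X = mat 1"
    using frenet_row_dot_constant[OF row row, where s = s]
    by (simp add: vec_eq_iff matrix_matrix_mult_def transpose_def mat_def X_def sum_3 vector_3 forall_3 ini)
  then have "X ** transpose X = mat 1" using matrix_left_right_inverse by blast
  then have "(X ** transpose X) $ 1 $ 1 = 1" by (simp add: mat_def)
  then have "m s \<bullet> m s = 1"
    by (simp add: matrix_matrix_mult_def transpose_def X_def vector_3 inner_vec_def)
  then show ?thesis by (simp add: norm_eq_1)
qed

lemma curvature_primitive:
  assumes "0 < \<alpha>"
  obtains \<theta> where "\<theta> 0 = 0" "\<And>s. (\<theta> has_real_derivative curvature c0 \<alpha> s) (at s)"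
    "(\<theta> \<longlongrightarrow> c0 * sqrt (pi / \<alpha>)) at_top"
proof -
  obtain \<theta> where \<theta>: "\<theta> 0 = 0" "\<And>s. (\<theta> has_real_derivative exp (- (\<alpha> / 4) * s\<^sup>2)) (at s)"
    "(\<theta> \<longlongrightarrow> sqrt (pi / (\<alpha> / 4)) / 2) at_top"
    using gaussian_primitive[of "\<alpha> / 4"] assms by auto
  have "sqrt (pi / (\<alpha> / 4)) = 2 * sqrt (pi / \<alpha>)"
    using real_sqrt_mult[of 4 "pi / \<alpha>"] by (simp add: mult.commute)
  then show thesis
    using that[of "\<lambda>s. c0 * \<theta> s"] \<theta> DERIV_cmult[OF \<theta>(2), of c0] tendsto_mult_left[OF \<theta>(3), of c0]
    by (simp add: curvature_def)
qed

text \<open>Since \<open>\<bar>m'\<bar> \<le> c\<close>, adding to a coordinate of \<open>m\<close> the primitive \<open>\<theta>\<close> of \<open>c\<close> makes it nondecreasing;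
  the sum is bounded because \<open>c\<close> is integrable, hence it converges, and so does \<open>\<theta>\<close>. The limit at
  minus infinity follows by reflection.\<close>

lemma tangent_tendsto:
  assumes c0: "0 < c0" and \<alpha>: "0 < \<alpha>"
  shows "(tangent c0 \<alpha> \<longlongrightarrow> A_plus c0 \<alpha>) at_top" "(tangent c0 \<alpha> \<longlongrightarrow> A_minus c0 \<alpha>) at_bot"
proof -
  obtain n b where sf: "serret_frenet (curvature c0 \<alpha>) (torsion \<alpha>) (tangent c0 \<alpha>) n b"
    by (rule tangent_serret_frenet)
  have row: "frenet_row (curvature c0 \<alpha>) (torsion \<alpha>) (\<lambda>s. tangent c0 \<alpha> s $ j) (\<lambda>s. n s $ j) (\<lambda>s. b s $ j)" for j
    using sf unfolding serret_frenet_iff_rows by blast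
  have ini: "(tangent c0 \<alpha> 0 $ j)\<^sup>2 + (n 0 $ j)\<^sup>2 + (b 0 $ j)\<^sup>2 = 1" for j
    using sf exhaust_3[of j] unfolding serret_frenet_iff_rows by auto
  obtain \<theta> where \<theta>: "\<And>s. (\<theta> has_real_derivative curvature c0 \<alpha> s) (at s)"
    and lim: "(\<theta> \<longlongrightarrow> c0 * sqrt (pi / \<alpha>)) at_top"
    using curvature_primitive[OF \<alpha>] by metis
  have c_pos: "0 \<le> curvature c0 \<alpha> s" for s using c0 by (simp add: curvature_def)
  have \<theta>_mono: "mono \<theta>" by (rule mono_if_derivative_nonneg[OF \<theta> c_pos])
  have \<theta>_le: "\<theta> s \<le> c0 * sqrt (pi / \<alpha>)" for s
    by (rule tendsto_lowerbound[OF lim])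
      (auto intro!: eventually_mono[OF eventually_ge_at_top[of s]] monoD[OF \<theta>_mono])
  have "\<exists>l. ((\<lambda>s. tangent c0 \<alpha> s $ j) \<longlongrightarrow> l) at_top" for j
  proof -
    have abs_le: "\<bar>tangent c0 \<alpha> s $ j\<bar> \<le> 1" "\<bar>n s $ j\<bar> \<le> 1" for s
    proof -
      have "(tangent c0 \<alpha> s $ j)\<^sup>2 + (n s $ j)\<^sup>2 + (b s $ j)\<^sup>2 = 1"
        using frenet_row_dot_constant[OF row[of j] row[of j], of s] ini[of j] by (simp add: power2_eq_square)
      then have "(tangent c0 \<alpha> s $ j)\<^sup>2 \<le> 1" "(n s $ j)\<^sup>2 \<le> 1"
        by (smt (verit) zero_le_power2)+
      then show "\<bar>tangent c0 \<alpha> s $ j\<bar> \<le> 1" "\<bar>n s $ j\<bar> \<le> 1"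
        by (simp_all add: abs_square_le_1)
    qed
    have d: "((\<lambda>s. tangent c0 \<alpha> s $ j + \<theta> s) has_real_derivative curvature c0 \<alpha> s * (n s $ j + 1)) (at s)" for s
      using row[of j] unfolding frenet_row_def
      by (auto intro!: derivative_eq_intros \<theta> simp: algebra_simps)
    have "mono (\<lambda>s. tangent c0 \<alpha> s $ j + \<theta> s)"
    proof (rule mono_if_derivative_nonneg[OF d])
      show "0 \<le> curvature c0 \<alpha> s * (n s $ j + 1)" for s
        using abs_le(2)[of s] c_pos[of s] by (intro mult_nonneg_nonneg) (auto simp: abs_le_iff)
    qed
    moreover have "tangent c0 \<alpha> s $ j + \<theta> s \<le> 1 + c0 * sqrt (pi / \<alpha>)" for s
      using abs_le(1)[of s] \<theta>_le[of s] by (auto simp: abs_le_iff)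
    ultimately obtain l where "((\<lambda>s. tangent c0 \<alpha> s $ j + \<theta> s) \<longlongrightarrow> l) at_top"
      using mono_bounded_tendsto_at_top by blast
    from tendsto_diff[OF this lim] show ?thesis by auto
  qed
  then obtain l where l: "\<And>j. ((\<lambda>s. tangent c0 \<alpha> s $ j) \<longlongrightarrow> l j) at_top" by metis
  then have L: "(tangent c0 \<alpha> \<longlongrightarrow> (\<chi> j. l j)) at_top"
    using l by (intro vec_tendstoI) simp
  then show "(tangent c0 \<alpha> \<longlongrightarrow> A_plus c0 \<alpha>) at_top"
    unfolding A_plus_def by (subst tendsto_Lim) auto
  define R :: "real^3 \<Rightarrow> real^3" where "R v = vector [v $ 1, - v $ 2, - v $ 3]" for v
  have "((\<lambda>s. R (tangent c0 \<alpha> s) $ j) \<longlongrightarrow> R (\<chi> j. l j) $ j) at_top" for j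
    using exhaust_3[of j] l tendsto_minus[OF l] by (auto simp: R_def vector_3)
  then have "((\<lambda>s. R (tangent c0 \<alpha> s)) \<longlongrightarrow> R (\<chi> j. l j)) at_top"
    by (rule vec_tendstoI)
  moreover have "tangent c0 \<alpha> (- s) = R (tangent c0 \<alpha> s)" for s
    by (simp add: vec_eq_iff forall_3 R_def vector_3 tangent_reflect)
  ultimately have "(tangent c0 \<alpha> \<longlongrightarrow> R (\<chi> j. l j)) at_bot"
    unfolding filterlim_at_bot_mirror by simp
  then show "(tangent c0 \<alpha> \<longlongrightarrow> A_minus c0 \<alpha>) at_bot"
    unfolding A_minus_def by (subst tendsto_Lim) auto
qed

section \<open>Tangents whose limit lies on the first axis\<close>

text \<open>The hypothetical situation to be excluded: \<open>x, y, z\<close> are the first coordinates of \<open>m, n, b\<close>, and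
  \<open>\<sigma>\<close> is the sign of the limit vector on the first axis.\<close>

locale axial_tangent =
  fixes c0 \<alpha> \<sigma> :: real and x y z :: "real \<Rightarrow> real"
  assumes c0: "0 < c0" and \<alpha>: "0 < \<alpha>" "\<alpha> < 1"
    and row: "frenet_row (curvature c0 \<alpha>) (torsion \<alpha>) x y z"
    and init: "x 0 = 1" "y 0 = 0" "z 0 = 0"
    and \<sigma>: "\<bar>\<sigma>\<bar> = 1"
    and x_tendsto: "(x \<longlongrightarrow> \<sigma>) at_top"

text \<open>By reflection the second and third coordinates of the common limit equal their own negatives, so
  they vanish, and the limit is a unit vector.\<close>

lemma axial_tangent_if_A_plus_eq_A_minus:
  assumes "0 < c0" "0 < \<alpha>" "\<alpha> < 1" and eq: "A_plus c0 \<alpha> = A_minus c0 \<alpha>"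
  shows "\<exists>\<sigma> x y z. axial_tangent c0 \<alpha> \<sigma> x y z"
proof -
  obtain n b where sf: "serret_frenet (curvature c0 \<alpha>) (torsion \<alpha>) (tangent c0 \<alpha>) n b"
    by (rule tangent_serret_frenet)
  note rows = sf[unfolded serret_frenet_iff_rows]
  note lim = tangent_tendsto[OF assms(1,2)]
  have comp: "((\<lambda>s. tangent c0 \<alpha> s $ j) \<longlongrightarrow> A_plus c0 \<alpha> $ j) at_top"
      "((\<lambda>s. tangent c0 \<alpha> (- s) $ j) \<longlongrightarrow> A_plus c0 \<alpha> $ j) at_top" for j
    using lim eq by (auto intro: tendsto_vec_nth simp: filterlim_at_bot_mirror)
  have zero: "A_plus c0 \<alpha> $ j = 0" if "j = 2 \<or> j = 3" for j
  proof -
    have "((\<lambda>s. tangent c0 \<alpha> (- s) $ j) \<longlongrightarrow> - A_plus c0 \<alpha> $ j) at_top"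
      using that tendsto_minus[OF comp(1)[of j]] by (auto simp: tangent_reflect)
    from tendsto_unique[OF _ this comp(2)] show ?thesis by simp
  qed
  have "((\<lambda>s. norm (tangent c0 \<alpha> s)) \<longlongrightarrow> norm (A_plus c0 \<alpha>)) at_top"
    using lim by (intro tendsto_norm)
  then have "norm (A_plus c0 \<alpha>) = 1"
    by (simp add: serret_frenet_norm_tangent[OF sf] tendsto_const_iff)
  then have "\<bar>A_plus c0 \<alpha> $ 1\<bar> = 1"
    using zero by (simp add: norm_vec_def L2_set_def sum_3)
  then have "axial_tangent c0 \<alpha> (A_plus c0 \<alpha> $ 1) (\<lambda>s. tangent c0 \<alpha> s $ 1) (\<lambda>s. n s $ 1) (\<lambda>s. b s $ 1)"
    using rows comp assms by unfold_locales auto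
  then show ?thesis by blast
qed

section \<open>Three consequences of an axial limit\<close>

lemma one_minus_cos_le_abs: "1 - cos t \<le> \<bar>t\<bar>" for t :: real
proof -
  have "1 - cos t = 2 * (sin (t / 2))\<^sup>2"
    using cos_double_sin[of "t / 2"] by simp
  also have "\<dots> = 2 * (\<bar>sin (t / 2)\<bar> * \<bar>sin (t / 2)\<bar>)" by (simp add: power2_eq_square)
  also have "\<dots> \<le> 2 * (1 * \<bar>t / 2\<bar>)"
    using abs_sin_x_le_abs_x[of "t / 2"] by (intro mult_left_mono mult_mono) auto
  finally show ?thesis by simp
qed

lemma real_le_exp_square_quarter: "t \<le> exp (t\<^sup>2 / 4)" for t :: real
proof -
  have "0 \<le> (t / 2 - 1)\<^sup>2" by simp
  then have "t \<le> 1 + t\<^sup>2 / 4" by (simp add: power2_eq_square field_simps)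
  also have "\<dots> \<le> exp (t\<^sup>2 / 4)" by (rule exp_ge_add_one_self)
  finally show ?thesis .
qed

text \<open>The integral of \<open>w sin \<phi>\<close> with \<open>w = exp (- \<alpha> s\<^sup>2 / 4)\<close> is positive because \<open>w sin \<phi>\<close> is the
  decreasing weight \<open>w / s\<close> times \<open>s sin \<phi>\<close>, and \<open>s sin \<phi>\<close> has the nonnegative primitive
  \<open>(2 / \<beta>) (1 - cos \<phi>)\<close>. Integration by parts leaves a boundary term \<open>W \<ge> 0\<close> and a nonnegative
  remainder \<open>J\<close>, which is nondecreasing and not constant.\<close>

lemma damped_sine_primitive_bounded_below:
  fixes \<alpha> \<beta> :: real and I :: "real \<Rightarrow> real"
  assumes pos: "0 < \<alpha>" "0 < \<beta>" and I0: "I 0 = 0"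
    and dI: "\<And>s. (I has_real_derivative exp (- \<alpha> * s\<^sup>2 / 4) * sin (\<beta> * s\<^sup>2 / 4)) (at s)"
  shows "\<exists>\<delta>>0. \<forall>\<^sub>F s in at_top. \<delta> \<le> I s"
proof -
  define w where "w s = exp (- \<alpha> * s\<^sup>2 / 4)" for s
  define W where "W s = w s * (2 / \<beta>) * (1 - cos (\<beta> * s\<^sup>2 / 4)) / s" for s
  define J where "J s = I s - W s" for s
  define J' where "J' s = (w s / s\<^sup>2 + \<alpha> * w s / 2) * (2 / \<beta>) * (1 - cos (\<beta> * s\<^sup>2 / 4))" for s
  have w_pos: "0 < w s" for s by (simp add: w_def)
  have dw: "(w has_real_derivative - (\<alpha> * s / 2) * w s) (at s)" for s
    unfolding w_def[abs_def] by (auto intro!: derivative_eq_intros)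
  have dJ: "(J has_real_derivative J' s) (at s)" if "0 < s" for s
    unfolding J_def[abs_def] W_def[abs_def] J'_def
    using that pos
    by (auto intro!: derivative_eq_intros dw dI[folded w_def] simp: field_simps power2_eq_square)
  have J'_nonneg: "0 \<le> J' s" for s
    unfolding J'_def using pos w_pos[of s] by (intro mult_nonneg_nonneg add_nonneg_nonneg) auto
  have J_mono: "J s \<le> J t" if "0 < s" "s \<le> t" for s t
    using diff_le_if_derivative_le[of s t "\<lambda>_. 0" "\<lambda>_. 0" J J'] that dJ J'_nonneg by auto
  have "(W \<longlongrightarrow> 0) (at_right 0)"
    unfolding W_def w_def using pos by real_asymp
  moreover have "(I \<longlongrightarrow> 0) (at_right 0)"
    using DERIV_isCont[OF dI[of 0]] I0 unfolding isCont_def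
    by (metis filterlim_at_split)
  ultimately have J_lim: "(J \<longlongrightarrow> 0) (at_right 0)"
    unfolding J_def using tendsto_diff by fastforce
  have J_nonneg: "0 \<le> J s" if "0 < s" for s
    by (rule tendsto_upperbound[OF J_lim])
      (use that J_mono in \<open>auto simp: eventually_at_right_field intro!: exI[of _ s]\<close>)
  \<comment> \<open>On \<open>[a, b]\<close> the phase \<open>\<beta> s\<^sup>2 / 4\<close> runs through \<open>[1 / 4, 1]\<close>, where the cosine is less than \<open>1\<close>.\<close>
  define a b where "a = 1 / sqrt \<beta>" and "b = 2 / sqrt \<beta>"
  have ab: "0 < a" "a < b" using pos by (auto simp: a_def b_def divide_strict_right_mono)
  have "J a < J b"
  proof (rule DERIV_pos_imp_increasing[OF ab(2)])
    fix s assume s: "a \<le> s" "s \<le> b"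
    have "s\<^sup>2 \<le> b\<^sup>2" using s ab by (intro power_mono) auto
    then have "\<beta> * s\<^sup>2 / 4 \<le> 1"
      using pos by (simp add: b_def power_divide field_simps)
    moreover have "0 < \<beta> * s\<^sup>2 / 4" using s ab pos by auto
    ultimately have "cos (\<beta> * s\<^sup>2 / 4) < cos 0"
      using pi_gt3 by (intro cos_monotone_0_pi) auto
    then have "0 < J' s"
      unfolding J'_def using pos w_pos[of s] s ab
      by (intro mult_pos_pos add_nonneg_pos) auto
    then show "\<exists>d. (J has_real_derivative d) (at s) \<and> 0 < d"
      using dJ[of s] s ab by auto
  qed
  then have "0 < J b" using J_nonneg[OF ab(1)] by linarith
  moreover have "J b \<le> I s" if "b \<le> s" for s
  proof -
    have "0 \<le> W s"
      unfolding W_def using pos w_pos[of s] that ab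
      by (intro divide_nonneg_nonneg mult_nonneg_nonneg) auto
    then show ?thesis using J_mono[of b s] that ab by (simp add: J_def)
  qed
  ultimately show ?thesis
    by (intro exI[of _ "J b"] conjI eventually_mono[OF eventually_ge_at_top[of b]])
qed

context axial_tangent
begin

abbreviation "c \<equiv> curvature c0 \<alpha>"
abbreviation "\<beta> \<equiv> sqrt (1 - \<alpha>\<^sup>2)"

lemma \<beta>: "0 < \<beta>" "\<beta> \<le> 1"
proof -
  have "\<alpha>\<^sup>2 < 1" using \<alpha> by (simp add: power_less_one_iff)
  then show "0 < \<beta>" "\<beta> \<le> 1" by auto
qed

lemma dx: "(x has_real_derivative c s * y s) (at s)"
  and dy: "(y has_real_derivative - c s * x s + \<beta> * s / 2 * z s) (at s)"
  and dz: "(z has_real_derivative - (\<beta> * s / 2) * y s) (at s)"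
  using row unfolding frenet_row_def torsion_def by auto

lemma c_pos: "0 < c s"
  using c0 by (simp add: curvature_def)

lemma c_deriv: "(c has_real_derivative - (\<alpha> * s / 2) * c s) (at s)"
  unfolding curvature_def[abs_def] by (auto intro!: derivative_eq_intros)

lemma c_tendsto: "(c \<longlongrightarrow> 0) at_top"
  unfolding curvature_def[abs_def] using \<alpha> by real_asymp

lemma sphere: "(x s)\<^sup>2 + (y s)\<^sup>2 + (z s)\<^sup>2 = 1"
  using frenet_row_dot_constant[OF row row, of s] init by (simp add: power2_eq_square)

lemma abs_le_1: "\<bar>x s\<bar> \<le> 1" "\<bar>y s\<bar> \<le> 1" "\<bar>z s\<bar> \<le> 1"
proof -
  have "(x s)\<^sup>2 \<le> 1" "(y s)\<^sup>2 \<le> 1" "(z s)\<^sup>2 \<le> 1"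
    using sphere[of s] by (smt (verit) zero_le_power2)+
  then show "\<bar>x s\<bar> \<le> 1" "\<bar>y s\<bar> \<le> 1" "\<bar>z s\<bar> \<le> 1" by (simp_all add: abs_square_le_1)
qed

lemma yz_tendsto: "(y \<longlongrightarrow> 0) at_top" "(z \<longlongrightarrow> 0) at_top"
proof -
  have "\<sigma>\<^sup>2 = 1" using \<sigma> by (metis power2_abs power_one)
  then have lim: "((\<lambda>s. sqrt (1 - (x s)\<^sup>2)) \<longlongrightarrow> 0) at_top"
    using tendsto_real_sqrt[OF tendsto_diff[OF tendsto_const[of 1] tendsto_power[OF x_tendsto, of 2]]]
    by simp
  have "\<bar>y s\<bar> \<le> sqrt (1 - (x s)\<^sup>2) \<and> \<bar>z s\<bar> \<le> sqrt (1 - (x s)\<^sup>2)" for s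
  proof -
    have "(y s)\<^sup>2 \<le> 1 - (x s)\<^sup>2" "(z s)\<^sup>2 \<le> 1 - (x s)\<^sup>2"
      using sphere[of s] zero_le_power2[of "y s"] zero_le_power2[of "z s"] by linarith+
    then show ?thesis by (auto intro!: real_le_rsqrt)
  qed
  then show "(y \<longlongrightarrow> 0) at_top" "(z \<longlongrightarrow> 0) at_top"
    by (auto intro!: Lim_null_comparison[OF _ lim])
qed

lemma yz_combination_tendsto:
  assumes "\<And>s. \<bar>p s\<bar> \<le> 1" "\<And>s. \<bar>q s\<bar> \<le> 1"
  shows "((\<lambda>s. y s * p s + z s * q s) \<longlongrightarrow> 0) at_top"
proof (rule Lim_null_comparison)
  show "((\<lambda>s. \<bar>y s\<bar> + \<bar>z s\<bar>) \<longlongrightarrow> 0) at_top"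
    using tendsto_add[OF tendsto_rabs_zero[OF yz_tendsto(1)] tendsto_rabs_zero[OF yz_tendsto(2)]]
    by simp
  have "\<bar>y s * p s + z s * q s\<bar> \<le> \<bar>y s\<bar> * 1 + \<bar>z s\<bar> * 1" for s
  proof -
    have "\<bar>y s * p s + z s * q s\<bar> \<le> \<bar>y s\<bar> * \<bar>p s\<bar> + \<bar>z s\<bar> * \<bar>q s\<bar>"
      by (metis abs_mult abs_triangle_ineq)
    also have "\<dots> \<le> \<bar>y s\<bar> * 1 + \<bar>z s\<bar> * 1"
      using assms by (intro add_mono mult_left_mono) auto
    finally show ?thesis .
  qed
  then show "\<forall>\<^sub>F s in at_top. norm (y s * p s + z s * q s) \<le> \<bar>y s\<bar> + \<bar>z s\<bar>" by simp
qed

text \<open>Rotating \<open>(y, z)\<close> by the angle \<open>\<phi>\<close> removes the torsion: \<open>f = y sin \<phi> + z cos \<phi>\<close> satisfies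
  \<open>f' = - c x sin \<phi>\<close>. Replacing \<open>x\<close> by \<open>1\<close> costs at most the total curvature \<open>c0 K\<close> pointwise, and
  thus \<open>(c0 K)\<^sup>2\<close> after integration against \<open>c\<close>, while \<open>f\<close> itself vanishes at both ends. So \<open>c0 \<delta>\<close>
  is at most \<open>(c0 K)\<^sup>2\<close>.\<close>

lemma curvature_lower_bound:
  assumes dI: "\<And>s. (I has_real_derivative exp (- \<alpha> * s\<^sup>2 / 4) * sin (\<beta> * s\<^sup>2 / 4)) (at s)"
    and I0: "I 0 = 0" and \<delta>: "\<forall>\<^sub>F s in at_top. \<delta> \<le> I s"
  shows "\<delta> \<le> c0 * (pi / \<alpha>)"
proof -
  define K where "K = sqrt (pi / \<alpha>)"
  define \<phi> where "\<phi> s = \<beta> * s\<^sup>2 / 4" for s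
  obtain \<theta> where \<theta>0: "\<theta> 0 = 0" and d\<theta>: "\<And>s. (\<theta> has_real_derivative c s) (at s)"
    and \<theta>_lim: "(\<theta> \<longlongrightarrow> c0 * K) at_top"
    unfolding K_def using curvature_primitive[OF \<alpha>(1)] by metis
  have \<theta>_mono: "\<theta> s \<le> \<theta> t" if "s \<le> t" for s t
    using mono_if_derivative_nonneg[OF d\<theta> less_imp_le[OF c_pos]] that by (rule monoD)
  have \<theta>_le: "\<theta> s \<le> c0 * K" for s
    by (rule tendsto_lowerbound[OF \<theta>_lim])
      (auto intro!: eventually_mono[OF eventually_ge_at_top[of s]] \<theta>_mono)
  have one_minus_x: "1 - x s \<le> c0 * K" if "0 \<le> s" for s
  proof -
    have "- x s - - x 0 \<le> \<theta> s - \<theta> 0"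
    proof (rule diff_le_if_derivative_le[OF that DERIV_minus[OF dx] d\<theta>])
      fix t
      show "- (c t * y t) \<le> c t"
        using mult_left_mono[of "- y t" 1 "c t"] abs_le_1(2)[of t] c_pos[of t] by (auto simp: abs_le_iff)
    qed
    then show ?thesis using \<theta>_le[of s] \<theta>0 init by simp
  qed
  define f where "f s = y s * sin (\<phi> s) + z s * cos (\<phi> s)" for s
  have df: "(f has_real_derivative - c s * sin (\<phi> s) * x s) (at s)" for s
    unfolding f_def[abs_def] \<phi>_def
    by (auto intro!: derivative_eq_intros dy dz simp: algebra_simps)
  have f_lim: "(f \<longlongrightarrow> 0) at_top"
    unfolding f_def by (rule yz_combination_tendsto) auto
  have bound: "f s + c0 * I s \<le> c0 * K * (c0 * K)" if s: "0 \<le> s" for s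
  proof -
    have "(f s + c0 * I s) - (f 0 + c0 * I 0) \<le> c0 * K * \<theta> s - c0 * K * \<theta> 0"
    proof (rule diff_le_if_derivative_le[OF s])
      fix t :: real
      assume t: "0 \<le> t"
      show "((\<lambda>s. f s + c0 * I s) has_real_derivative c t * (sin (\<phi> t) * (1 - x t))) (at t)"
        by (auto intro!: derivative_eq_intros df dI simp: algebra_simps curvature_def \<phi>_def)
      show "((\<lambda>s. c0 * K * \<theta> s) has_real_derivative c0 * K * c t) (at t)"
        by (auto intro!: derivative_eq_intros d\<theta>)
      have "sin (\<phi> t) * (1 - x t) \<le> 1 * (1 - x t)"
        using abs_le_1(1)[of t] by (intro mult_right_mono) (auto simp: abs_le_iff)
      then have "sin (\<phi> t) * (1 - x t) \<le> c0 * K" using one_minus_x[OF t] by simp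
      then show "c t * (sin (\<phi> t) * (1 - x t)) \<le> c0 * K * c t"
        using c_pos[of t] by (simp add: mult.commute)
    qed
    moreover have "c0 * K * \<theta> s \<le> c0 * K * (c0 * K)"
      using \<theta>_le[of s] c0 \<alpha> by (intro mult_left_mono) (auto simp: K_def)
    ultimately show ?thesis using \<theta>0 I0 init by (simp add: f_def \<phi>_def)
  qed
  have "0 + c0 * \<delta> \<le> c0 * K * (c0 * K)"
  proof (rule tendsto_upperbound)
    show "((\<lambda>s. f s + c0 * \<delta>) \<longlongrightarrow> 0 + c0 * \<delta>) at_top"
      by (intro tendsto_intros f_lim)
    show "\<forall>\<^sub>F s in at_top. f s + c0 * \<delta> \<le> c0 * K * (c0 * K)"
      using \<delta> eventually_ge_at_top[of 0]
    proof eventually_elim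
      case (elim s)
      then show ?case using bound[of s] mult_left_mono[of \<delta> "I s" c0] c0 by linarith
    qed
  qed simp
  then have "c0 * \<delta> \<le> c0 * (c0 * (K * K))" by (simp add: mult_ac)
  then have "\<delta> \<le> c0 * (K * K)" using c0 by (simp only: mult_le_cancel_left_pos)
  moreover have "K * K = pi / \<alpha>" unfolding K_def using \<alpha> by simp
  ultimately show ?thesis by simp
qed

text \<open>Without torsion, \<open>(x, y) = (cos \<theta>, - sin \<theta>)\<close> with \<open>\<theta>\<close> the primitive of \<open>c\<close>. With torsion, replace
  \<open>y\<close> by the rotated \<open>e = y cos \<phi> - z sin \<phi>\<close>, for which \<open>e' = - c x cos \<phi>\<close>. Then
  \<open>E = x sin \<theta> + e cos \<theta>\<close>, which would be constant for \<open>\<phi> = 0\<close>, has a derivative of size at most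
  \<open>3 c \<phi>\<close>, whose integral is \<open>O(\<beta>)\<close>. At infinity \<open>e\<close> vanishes and \<open>E\<close> becomes \<open>\<sigma> sin \<theta>\<close>.\<close>

lemma sin_total_curvature_bound:
  "\<bar>sin (c0 * sqrt (pi / \<alpha>))\<bar> \<le> 6 * \<beta> * c0 / (\<alpha> * sqrt \<alpha>)"
proof -
  define B where "B = 6 * \<beta> * c0 / (\<alpha> * sqrt \<alpha>)"
  define \<phi> where "\<phi> s = \<beta> * s\<^sup>2 / 4" for s
  define v where "v s = exp (- \<alpha> * s\<^sup>2 / 8)" for s
  obtain \<theta> where \<theta>0: "\<theta> 0 = 0" and d\<theta>: "\<And>s. (\<theta> has_real_derivative c s) (at s)"
    and \<theta>_lim: "(\<theta> \<longlongrightarrow> c0 * sqrt (pi / \<alpha>)) at_top"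
    using curvature_primitive[OF \<alpha>(1)] by metis
  define e where "e s = y s * cos (\<phi> s) - z s * sin (\<phi> s)" for s
  define E where "E s = x s * sin (\<theta> s) + e s * cos (\<theta> s)" for s
  define E' where "E' s = c s * (sin (\<theta> s) * (y s - e s) + cos (\<theta> s) * x s * (1 - cos (\<phi> s)))" for s
  have de: "(e has_real_derivative - c s * cos (\<phi> s) * x s) (at s)" for s
    unfolding e_def[abs_def] \<phi>_def
    by (auto intro!: derivative_eq_intros dy dz simp: algebra_simps)
  have dE: "(E has_real_derivative E' s) (at s)" for s
    unfolding E_def[abs_def] E'_def
    by (auto intro!: derivative_eq_intros dx de d\<theta> simp: algebra_simps)
  have dv: "((\<lambda>s. - B * v s) has_real_derivative B * (\<alpha> * s / 4) * v s) (at s)" for s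
    unfolding v_def by (auto intro!: derivative_eq_intros)
  have E'_le: "\<bar>E' s\<bar> \<le> B * (\<alpha> * s / 4) * v s" if s: "0 \<le> s" for s
  proof -
    have \<phi>0: "0 \<le> \<phi> s" using \<beta> by (simp add: \<phi>_def)
    have c1: "\<bar>1 - cos (\<phi> s)\<bar> \<le> \<phi> s" using one_minus_cos_le_abs[of "\<phi> s"] \<phi>0 by simp
    have s1: "\<bar>sin (\<phi> s)\<bar> \<le> \<phi> s" using abs_sin_x_le_abs_x[of "\<phi> s"] \<phi>0 by simp
    have "y s - e s = y s * (1 - cos (\<phi> s)) + z s * sin (\<phi> s)" by (simp add: e_def algebra_simps)
    also have "\<bar>\<dots>\<bar> \<le> \<bar>y s\<bar> * \<bar>1 - cos (\<phi> s)\<bar> + \<bar>z s\<bar> * \<bar>sin (\<phi> s)\<bar>"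
      by (metis abs_mult abs_triangle_ineq)
    also have "\<dots> \<le> 1 * \<phi> s + 1 * \<phi> s"
      using c1 s1 abs_le_1 by (intro add_mono mult_mono) auto
    finally have ye: "\<bar>y s - e s\<bar> \<le> 2 * \<phi> s" by simp
    have "\<bar>sin (\<theta> s) * (y s - e s)\<bar> \<le> 1 * (2 * \<phi> s)"
      unfolding abs_mult using ye by (intro mult_mono) auto
    moreover have "\<bar>cos (\<theta> s) * x s * (1 - cos (\<phi> s))\<bar> \<le> 1 * 1 * \<phi> s"
      unfolding abs_mult using c1 abs_le_1 by (intro mult_mono) auto
    ultimately have "\<bar>sin (\<theta> s) * (y s - e s) + cos (\<theta> s) * x s * (1 - cos (\<phi> s))\<bar> \<le> 3 * \<phi> s"
      by linarith
    then have "\<bar>E' s\<bar> \<le> c s * (3 * \<phi> s)"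
      unfolding E'_def abs_mult using c_pos[of s] by simp
    \<comment> \<open>Half of the Gaussian absorbs one factor \<open>s\<close>; the remaining \<open>s * v s\<close> has an elementary primitive.\<close>
    also have "\<dots> = 3 / 4 * \<beta> * c0 * (s * v s) * (s * v s)"
    proof -
      have "v s * v s = exp (- \<alpha> * s\<^sup>2 / 4)" by (simp add: v_def exp_add[symmetric])
      then show ?thesis by (simp add: curvature_def \<phi>_def power2_eq_square)
    qed
    also have "\<dots> \<le> 3 / 4 * \<beta> * c0 * (2 / sqrt \<alpha>) * (s * v s)"
    proof -
      have "s * sqrt \<alpha> / sqrt 2 \<le> exp ((s * sqrt \<alpha> / sqrt 2)\<^sup>2 / 4)"
        by (rule real_le_exp_square_quarter)
      also have "(s * sqrt \<alpha> / sqrt 2)\<^sup>2 / 4 = \<alpha> * s\<^sup>2 / 8"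
        using \<alpha> by (simp add: power_mult_distrib power_divide)
      finally have "s * sqrt \<alpha> \<le> sqrt 2 * exp (\<alpha> * s\<^sup>2 / 8)" by (simp add: field_simps)
      also have "\<dots> \<le> 2 * exp (\<alpha> * s\<^sup>2 / 8)"
        using real_sqrt_le_mono[of 2 4] by (intro mult_right_mono) auto
      finally have "s * sqrt \<alpha> * v s \<le> 2 * exp (\<alpha> * s\<^sup>2 / 8) * v s"
        by (rule mult_right_mono) (simp add: v_def)
      also have "\<dots> = 2" by (simp add: v_def exp_add[symmetric])
      finally have "s * v s \<le> 2 / sqrt \<alpha>" using \<alpha> by (simp add: field_simps)
      then show ?thesis
        using c0 \<beta> s by (intro mult_right_mono mult_left_mono) (auto simp: v_def)
    qed
    also have "\<dots> = B * (\<alpha> * s / 4) * v s"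
      using \<alpha> by (simp add: B_def field_simps)
    finally show ?thesis .
  qed
  have E0: "E 0 = 0" by (simp add: E_def e_def \<theta>0 init)
  have B0: "0 \<le> B" unfolding B_def using c0 \<beta> \<alpha> by (intro divide_nonneg_nonneg mult_nonneg_nonneg) auto
  have E'_le2: "E' s \<le> B * (\<alpha> * s / 4) * v s" "- E' s \<le> B * (\<alpha> * s / 4) * v s" if "0 \<le> s" for s
    using E'_le[OF that] by linarith+
  have E_le: "\<bar>E s\<bar> \<le> B" if s: "0 \<le> s" for s
  proof -
    have "E s - E 0 \<le> - B * v s - - B * v 0"
      by (rule diff_le_if_derivative_le[OF s dE dv E'_le2(1)])
    moreover have "- E s - - E 0 \<le> - B * v s - - B * v 0"
      by (rule diff_le_if_derivative_le[OF s DERIV_minus[OF dE] dv E'_le2(2)])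
    moreover have "v 0 = 1" "0 \<le> B * v s" using B0 by (auto simp: v_def)
    ultimately show ?thesis using E0 by auto
  qed
  have e_lim: "(e \<longlongrightarrow> 0) at_top"
    using yz_combination_tendsto[of "\<lambda>s. cos (\<phi> s)" "\<lambda>s. - sin (\<phi> s)"]
    unfolding e_def by simp
  have "((\<lambda>s. \<bar>E s\<bar>) \<longlongrightarrow> \<bar>\<sigma> * sin (c0 * sqrt (pi / \<alpha>)) + 0 * cos (c0 * sqrt (pi / \<alpha>))\<bar>) at_top"
    unfolding E_def by (intro tendsto_intros x_tendsto \<theta>_lim e_lim)
  then have "\<bar>\<sigma> * sin (c0 * sqrt (pi / \<alpha>)) + 0 * cos (c0 * sqrt (pi / \<alpha>))\<bar> \<le> B"
    by (rule tendsto_upperbound)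
      (auto intro!: eventually_mono[OF eventually_ge_at_top[of 0]] E_le)
  then show ?thesis using \<sigma> by (simp add: abs_mult B_def)
qed

text \<open>Put \<open>u = 1 - \<sigma> x \<ge> 0\<close> and \<open>F = s u - \<sigma> (2 c / \<beta>) z\<close>. The terms with \<open>y\<close> cancel in \<open>F'\<close>, leaving
  \<open>F' = u + \<sigma> (\<alpha> s c / \<beta>) z\<close>. The sphere relation gives \<open>z\<^sup>2 \<le> 2 u\<close>, so the error term is at most
  \<open>u / 2\<close> plus the square of its coefficient, and that square has a total integral at most
  \<open>B = 2 sqrt \<alpha> c0\<^sup>2 / \<beta>\<^sup>2\<close>. Since \<open>F\<close> starts and ends at \<open>0\<close>, the integral of \<open>u / 2\<close> is at most \<open>B\<close>.
  On \<open>[0, r]\<close>, where \<open>r\<close> is small in terms of \<open>c0\<close> only, \<open>u \<ge> c0\<^sup>2 s\<^sup>2 / 8\<close> for either sign \<open>\<sigma>\<close>.\<close>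

lemma damping_lower_bound:
  assumes r: "0 < r" "r \<le> 1 / 2" "c0 * r \<le> 1 / 4" "r \<le> c0 / 4"
  shows "r ^ 3 / 96 \<le> sqrt \<alpha> / \<beta>\<^sup>2"
proof -
  define w where "w s = exp (- \<alpha> * s\<^sup>2 / 4)" for s
  have cw: "c s = c0 * w s" for s by (simp add: curvature_def w_def)
  define u where "u s = 1 - \<sigma> * x s" for s
  define F where "F s = s * u s - \<sigma> * (2 * c s / \<beta>) * z s" for s
  define B where "B = 2 * sqrt \<alpha> * c0\<^sup>2 / \<beta>\<^sup>2"
  have \<sigma>x: "(\<sigma> * x s)\<^sup>2 = (x s)\<^sup>2" "\<bar>\<sigma> * x s\<bar> \<le> 1" for s
    using \<sigma> abs_le_1(1)[of s] by (auto simp: abs_mult abs_if power_mult_distrib split: if_splits)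
  have u0: "0 \<le> u s" for s using \<sigma>x(2)[of s] by (auto simp: u_def abs_le_iff)
  have z_u: "(z s)\<^sup>2 \<le> 2 * u s" for s
  proof -
    have "(z s)\<^sup>2 \<le> 1 - (\<sigma> * x s)\<^sup>2" using sphere[of s] \<sigma>x(1)[of s] zero_le_power2[of "y s"] by linarith
    also have "\<dots> = 2 * u s - (u s)\<^sup>2" by (simp add: u_def power2_eq_square algebra_simps)
    also have "\<dots> \<le> 2 * u s" by simp
    finally show ?thesis .
  qed
  have du: "(u has_real_derivative - \<sigma> * c s * y s) (at s)" for s
    unfolding u_def[abs_def] by (auto intro!: derivative_eq_intros dx)
  have dF: "(F has_real_derivative u s + \<sigma> * (\<alpha> * s * c s / \<beta>) * z s) (at s)" for s
    unfolding F_def[abs_def] using \<beta>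
    by (auto intro!: derivative_eq_intros du dz c_deriv simp: field_simps)
  have dw: "((\<lambda>s. B * w s) has_real_derivative - B * (\<alpha> * s / 2) * w s) (at s)" for s
    unfolding w_def by (auto intro!: derivative_eq_intros)
  have F_lim: "(F \<longlongrightarrow> 0) at_top"
  proof -
    have u_lim: "(u \<longlongrightarrow> 0) at_top"
      using tendsto_diff[OF tendsto_const[of 1] tendsto_mult[OF tendsto_const[of \<sigma>] x_tendsto]] \<sigma>
      unfolding u_def by (auto simp: abs_if split: if_splits)
    \<comment> \<open>\<open>u\<close> is at most the remaining integral of \<open>c\<close>, which is compared with that of
       \<open>(t / s) * c t\<close> over \<open>t \<ge> s\<close>; the latter has the primitive \<open>- 2 / (\<alpha> * s) * c t\<close>.\<close>
    have u_le: "u s \<le> 2 / (\<alpha> * s) * c s" if s: "0 < s" for s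
    proof -
      define h where "h t = 2 / (\<alpha> * s) * c t - u t" for t
      have "h t \<le> h s" if t: "s \<le> t" for t
      proof -
        have "h t - h s \<le> 0 - (0::real)"
        proof (rule diff_le_if_derivative_le[OF t])
          fix p assume p: "s \<le> p"
          show "(h has_real_derivative - (p / s) * c p + \<sigma> * c p * y p) (at p)"
            unfolding h_def[abs_def] using s \<alpha>
            by (auto intro!: derivative_eq_intros c_deriv du simp: field_simps)
          have "\<sigma> * y p \<le> 1"
            using \<sigma> abs_le_1(2)[of p] by (auto simp: abs_if split: if_splits)
          also have "1 \<le> p / s" using p s by simp
          finally have "c p * (\<sigma> * y p) \<le> c p * (p / s)"
            using c_pos[of p] by (intro mult_left_mono) auto
          then show "- (p / s) * c p + \<sigma> * c p * y p \<le> 0" by (simp add: mult_ac)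
        qed auto
        then show ?thesis by simp
      qed
      moreover have "(h \<longlongrightarrow> 2 / (\<alpha> * s) * 0 - 0) at_top"
        unfolding h_def by (intro tendsto_intros c_tendsto u_lim)
      ultimately have "0 \<le> h s"
        by (intro tendsto_upperbound[of h 0 at_top])
          (auto intro!: eventually_mono[OF eventually_ge_at_top[of s]])
      then show ?thesis by (simp add: h_def)
    qed
    have "((\<lambda>s. s * u s) \<longlongrightarrow> 0) at_top"
    proof (rule Lim_null_comparison)
      show "((\<lambda>s. 2 / \<alpha> * c s) \<longlongrightarrow> 0) at_top"
        using tendsto_mult_left[OF c_tendsto, of "2 / \<alpha>"] by simp
      show "\<forall>\<^sub>F s in at_top. norm (s * u s) \<le> 2 / \<alpha> * c s"
        using eventually_gt_at_top[of 0]
      proof eventually_elim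
        case (elim s)
        have "s * u s \<le> s * (2 / (\<alpha> * s) * c s)"
          using u_le[OF elim] elim by (intro mult_left_mono) auto
        also have "\<dots> = 2 / \<alpha> * c s" using elim by simp
        finally show ?case using u0[of s] elim by simp
      qed
    qed
    moreover have "((\<lambda>s. \<sigma> * (2 * c s / \<beta>) * z s) \<longlongrightarrow> \<sigma> * (2 * 0 / \<beta>) * 0) at_top"
      using \<beta> by (intro tendsto_intros c_tendsto yz_tendsto) auto
    ultimately show ?thesis
      unfolding F_def using tendsto_diff by fastforce
  qed
  have key: "u s / 2 \<le> u s + \<sigma> * (\<alpha> * s * c s / \<beta>) * z s + B * (\<alpha> * s / 2) * w s" if s: "0 \<le> s" for s
  proof -
    define k where "k = \<alpha> * s * c s / \<beta>"
    have "\<bar>\<sigma> * k * z s\<bar> = \<bar>k\<bar> * \<bar>z s\<bar>" using \<sigma> by (simp add: abs_mult)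
    also have "\<dots> \<le> k\<^sup>2 + (z s)\<^sup>2 / 4"
    proof -
      have "0 \<le> (\<bar>k\<bar> - \<bar>z s\<bar> / 2)\<^sup>2" by simp
      then show ?thesis by (simp add: power2_diff power_divide)
    qed
    also have "\<dots> \<le> k\<^sup>2 + u s / 2" using z_u[of s] by simp
    finally have 1: "\<bar>\<sigma> * k * z s\<bar> \<le> k\<^sup>2 + u s / 2" .
    \<comment> \<open>One factor \<open>s * w s\<close> is bounded by \<open>1 / sqrt \<alpha>\<close>; the other has an elementary primitive.\<close>
    have "sqrt \<alpha> * s \<le> exp ((sqrt \<alpha> * s)\<^sup>2 / 4)" by (rule real_le_exp_square_quarter)
    then have "sqrt \<alpha> * s * w s \<le> exp (\<alpha> * s\<^sup>2 / 4) * w s"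
      using \<alpha> by (intro mult_right_mono) (auto simp: w_def power_mult_distrib)
    also have "\<dots> = 1" by (simp add: w_def exp_add[symmetric])
    finally have sw: "sqrt \<alpha> * s * w s \<le> 1" .
    have a3: "\<alpha>\<^sup>2 = \<alpha> * sqrt \<alpha> * sqrt \<alpha>" using \<alpha> by (simp add: power2_eq_square)
    have "k\<^sup>2 = (c0\<^sup>2 / \<beta>\<^sup>2 * \<alpha> * sqrt \<alpha> * s * w s) * (sqrt \<alpha> * s * w s)"
      unfolding k_def cw power_divide power_mult_distrib a3 by (simp add: power2_eq_square)
    also have "\<dots> \<le> (c0\<^sup>2 / \<beta>\<^sup>2 * \<alpha> * sqrt \<alpha> * s * w s) * 1"
      using sw s \<alpha> by (intro mult_left_mono mult_nonneg_nonneg) (auto simp: w_def)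
    also have "\<dots> = B * (\<alpha> * s / 2) * w s" by (simp add: B_def)
    finally show ?thesis using 1 by (simp add: k_def[symmetric] abs_le_iff)
  qed
  \<comment> \<open>\<open>W\<close> increases at rate at least \<open>u / 2\<close>, from \<open>- B\<close> at \<open>0\<close> to its limit \<open>0\<close>.\<close>
  define W where "W s = F s - B * w s" for s
  have dW: "(W has_real_derivative u s + \<sigma> * (\<alpha> * s * c s / \<beta>) * z s + B * (\<alpha> * s / 2) * w s) (at s)" for s
    using DERIV_diff[OF dF dw] unfolding W_def[abs_def] by simp
  have W_mono: "W s \<le> W t" if "0 \<le> s" "s \<le> t" for s t
  proof -
    have "0 - (0::real) \<le> W t - W s"
    proof (rule diff_le_if_derivative_le[OF that(2) DERIV_const dW])
      fix p assume "s \<le> p"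
      then show "0 \<le> u p + \<sigma> * (\<alpha> * p * c p / \<beta>) * z p + B * (\<alpha> * p / 2) * w p"
        using key[of p] u0[of p] that by linarith
    qed
    then show ?thesis by simp
  qed
  have "(w \<longlongrightarrow> 0) at_top" unfolding w_def[abs_def] using \<alpha> by real_asymp
  then have W_lim: "(W \<longlongrightarrow> 0) at_top"
    using tendsto_diff[OF F_lim tendsto_mult_left[of w 0 at_top B]] unfolding W_def by simp
  have "W r \<le> 0"
    by (rule tendsto_lowerbound[OF W_lim])
      (use r in \<open>auto intro!: eventually_mono[OF eventually_ge_at_top[of r]] W_mono\<close>)
  moreover have "W 0 = - B" by (simp add: W_def F_def w_def init)
  moreover have "c0\<^sup>2 * r ^ 3 / 48 - c0\<^sup>2 * 0 ^ 3 / 48 \<le> W r - W 0"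
  proof (rule diff_le_if_derivative_le[OF less_imp_le[OF r(1)] _ dW])
    fix s assume s: "0 \<le> s" "s \<le> r"
    show "((\<lambda>s. c0\<^sup>2 * s ^ 3 / 48) has_real_derivative c0\<^sup>2 * s\<^sup>2 / 16) (at s)"
      by (auto intro!: derivative_eq_intros)
    have c_le: "c t \<le> c0" for t
      unfolding curvature_def using c0 \<alpha> by auto
    have x_ge: "3 / 4 \<le> x t" if t: "0 \<le> t" "t \<le> r" for t
    proof -
      have "- c0 * t - - c0 * 0 \<le> x t - x 0"
      proof (rule diff_le_if_derivative_le[OF t(1) _ dx])
        show "((\<lambda>t. - c0 * t) has_real_derivative - c0) (at p)" for p
          by (auto intro!: derivative_eq_intros)
        have "\<bar>c p * y p\<bar> \<le> c0 * 1" for p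
          unfolding abs_mult using c_le[of p] c_pos[of p] abs_le_1(2)[of p] c0 by (intro mult_mono) auto
        then show "- c0 \<le> c p * y p" for p by (smt (verit))
      qed
      moreover have "c0 * t \<le> c0 * r" using t c0 by simp
      ultimately show ?thesis using init(1) r(3) mult_minus_left[of c0 t] mult_zero_right[of "- c0"]
        by linarith
    qed
    have c_ge: "15 / 16 * c0 \<le> c t" if t: "0 \<le> t" "t \<le> r" for t
    proof -
      have "\<alpha> * t\<^sup>2 \<le> 1 * (1 / 2)\<^sup>2"
        using t r \<alpha> by (intro mult_mono power_mono) auto
      moreover have "1 + - \<alpha> * t\<^sup>2 / 4 \<le> w t"
        unfolding w_def by (rule exp_ge_add_one_self)
      ultimately have "15 / 16 \<le> w t" by (simp add: power2_eq_square)
      then show ?thesis using c0 by (simp add: cw)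
    qed
    have y_le: "y t \<le> - (c0 * t / 2)" if t: "0 \<le> t" "t \<le> r" for t
    proof -
      have "y t - y 0 \<le> - (c0 * t / 2) - - (c0 * 0 / 2)"
      proof (rule diff_le_if_derivative_le[OF t(1) dy])
        show "((\<lambda>t. - (c0 * t / 2)) has_real_derivative - (c0 / 2)) (at p)" for p
          by (auto intro!: derivative_eq_intros)
        fix p assume p: "0 \<le> p" "p \<le> t"
        have "15 / 16 * c0 * (3 / 4) \<le> c p * x p"
          using c_ge[of p] x_ge[of p] c0 p t by (intro mult_mono) auto
        moreover have "\<beta> * p / 2 * z p \<le> 1 * (c0 / 4) / 2 * 1"
        proof -
          have "\<beta> * p / 2 * z p \<le> \<beta> * p / 2 * 1"
            using \<beta> p abs_le_1(3)[of p] by (intro mult_left_mono) (auto simp: abs_le_iff)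
          also have "\<dots> \<le> 1 * (c0 / 4) / 2 * 1"
            using \<beta> p t r c0 by (intro mult_mono divide_right_mono) auto
          finally show ?thesis .
        qed
        ultimately show "- c p * x p + \<beta> * p / 2 * z p \<le> - (c0 / 2)"
          using c0 mult_minus_left[of "c p" "x p"] by linarith
      qed
      then show ?thesis using init by simp
    qed
    \<comment> \<open>For \<open>\<sigma> = 1\<close> the tangent has already turned away from the axis; for \<open>\<sigma> = - 1\<close> it is still nearly opposite to its limit.\<close>
    have "c0\<^sup>2 * s\<^sup>2 / 8 \<le> u s"
    proof (cases "\<sigma> = 1")
      case True
      have "c0\<^sup>2 * s\<^sup>2 / 8 - c0\<^sup>2 * 0\<^sup>2 / 8 \<le> u s - u 0"
      proof (rule diff_le_if_derivative_le[OF s(1) _ du])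
        show "((\<lambda>t. c0\<^sup>2 * t\<^sup>2 / 8) has_real_derivative c0\<^sup>2 * t / 4) (at t)" for t
          by (auto intro!: derivative_eq_intros)
        fix t assume t: "0 \<le> t" "t \<le> s"
        have "15 / 32 * (c0\<^sup>2 * t) = 15 / 16 * c0 * (c0 * t / 2)"
          by (simp add: power2_eq_square)
        also have "\<dots> \<le> c t * - y t"
          using c_ge[of t] y_le[of t] c_pos[of t] t s c0 by (intro mult_mono) auto
        also have "\<dots> = - \<sigma> * c t * y t" using True by simp
        finally have "15 / 32 * (c0\<^sup>2 * t) \<le> - \<sigma> * c t * y t" .
        moreover have "0 \<le> c0\<^sup>2 * t" using t by simp
        ultimately show "c0\<^sup>2 * t / 4 \<le> - \<sigma> * c t * y t" by linarith
      qed
      then show ?thesis using True init by (simp add: u_def)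
    next
      case False
      then have "u s = 1 + x s" using \<sigma> by (auto simp: u_def abs_if split: if_splits)
      moreover have "(c0 * s)\<^sup>2 \<le> 1\<^sup>2"
      proof (rule power_mono)
        have "c0 * s \<le> c0 * r" using s c0 by (intro mult_left_mono) auto
        then show "c0 * s \<le> 1" using r by linarith
      qed (use s c0 in simp)
      ultimately show ?thesis using x_ge[OF s] by (simp add: power_mult_distrib)
    qed
    then show "c0\<^sup>2 * s\<^sup>2 / 16 \<le> u s + \<sigma> * (\<alpha> * s * c s / \<beta>) * z s + B * (\<alpha> * s / 2) * w s"
      using key[OF s(1)] by linarith
  qed
  ultimately have "c0\<^sup>2 * (r ^ 3 / 48) \<le> c0\<^sup>2 * (2 * (sqrt \<alpha> / \<beta>\<^sup>2))"
    by (simp add: B_def mult.commute)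
  then have "r ^ 3 / 48 \<le> 2 * (sqrt \<alpha> / \<beta>\<^sup>2)"
    by (rule mult_left_le_imp_le) (use c0 in simp)
  then show ?thesis by linarith
qed

end

section \<open>Distinct limiting vectors\<close>

theorem proposition1p5:
  shows "(\<forall>\<alpha>::real. 0 < \<alpha> \<and> \<alpha> < 1 \<longrightarrow>
           (\<exists>c0s::real. 0 < c0s \<and>
             (\<forall>c0. 0 < c0 \<and> c0 < c0s \<longrightarrow> A_plus c0 \<alpha> \<noteq> A_minus c0 \<alpha>)))
       \<and> (\<forall>c0::real. 0 < c0 \<longrightarrow>
           (\<exists>\<alpha>0::real. 0 < \<alpha>0 \<and> \<alpha>0 \<le> 1 \<and>
             (\<forall>\<alpha>. 0 < \<alpha> \<and> \<alpha> < \<alpha>0 \<longrightarrow> A_plus c0 \<alpha> \<noteq> A_minus c0 \<alpha>)))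
       \<and> (\<forall>c0::real. 0 < c0 \<and> (\<forall>k::nat. c0 \<noteq> real k * sqrt pi) \<longrightarrow>
           (\<exists>\<alpha>1::real. 0 < \<alpha>1 \<and> 0 < 1 - \<alpha>1 \<and>
             (\<forall>\<alpha>. \<alpha>1 < \<alpha> \<and> \<alpha> < 1 \<longrightarrow> A_plus c0 \<alpha> \<noteq> A_minus c0 \<alpha>)))"
proof (intro conjI allI impI)
  fix \<alpha> :: real
  assume \<alpha>: "0 < \<alpha> \<and> \<alpha> < 1"
  then have "\<alpha>\<^sup>2 < 1" by (simp add: power_less_one_iff)
  then have \<beta>: "0 < sqrt (1 - \<alpha>\<^sup>2)" by simp
  have "continuous_on UNIV (\<lambda>s. exp (- \<alpha> * s\<^sup>2 / 4) * sin (sqrt (1 - \<alpha>\<^sup>2) * s\<^sup>2 / 4))"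
    by (intro continuous_intros) auto
  then obtain I where I0: "I 0 = 0" and
    dI: "\<And>s. (I has_real_derivative exp (- \<alpha> * s\<^sup>2 / 4) * sin (sqrt (1 - \<alpha>\<^sup>2) * s\<^sup>2 / 4)) (at s)"
    using continuous_has_antiderivative unfolding has_real_derivative_iff_has_vector_derivative by blast
  obtain \<delta> where \<delta>: "0 < \<delta>" "\<forall>\<^sub>F s in at_top. \<delta> \<le> I s"
    using damped_sine_primitive_bounded_below[OF conjunct1[OF \<alpha>] \<beta> I0 dI] by blast
  show "\<exists>c0s>0. \<forall>c0. 0 < c0 \<and> c0 < c0s \<longrightarrow> A_plus c0 \<alpha> \<noteq> A_minus c0 \<alpha>"
  proof (intro exI[of _ "\<delta> * \<alpha> / pi"] conjI allI impI notI)
    show "0 < \<delta> * \<alpha> / pi" using \<delta> \<alpha> by simp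
    fix c0 assume c0: "0 < c0 \<and> c0 < \<delta> * \<alpha> / pi" and "A_plus c0 \<alpha> = A_minus c0 \<alpha>"
    then obtain \<sigma> x y z where "axial_tangent c0 \<alpha> \<sigma> x y z"
      using axial_tangent_if_A_plus_eq_A_minus \<alpha> by blast
    then have "\<delta> \<le> c0 * (pi / \<alpha>)"
      by (rule axial_tangent.curvature_lower_bound[OF _ dI I0 \<delta>(2)])
    then show False using c0 \<alpha> by (simp add: field_simps)
  qed
next
  fix c0 :: real
  assume c0: "0 < c0"
  \<comment> \<open>The constraints on \<open>r\<close> are those of \<open>damping_lower_bound\<close>; with \<open>\<alpha> \<le> 1 / 2\<close>, and so \<open>\<beta>\<^sup>2 \<ge> 3 / 4\<close>,
     that bound reads \<open>sqrt \<alpha> \<ge> r^3 / 128\<close>.\<close>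
  define r where "r = min (1 / 2) (min (1 / (4 * c0)) (c0 / 4))"
  have r: "0 < r" "r \<le> 1 / 2" "r \<le> c0 / 4" using c0 by (auto simp: r_def)
  have "r \<le> 1 / (4 * c0)" by (simp add: r_def)
  then have cr: "c0 * r \<le> 1 / 4" using c0 by (simp add: field_simps)
  show "\<exists>\<alpha>0>0. \<alpha>0 \<le> 1 \<and> (\<forall>\<alpha>. 0 < \<alpha> \<and> \<alpha> < \<alpha>0 \<longrightarrow> A_plus c0 \<alpha> \<noteq> A_minus c0 \<alpha>)"
  proof (intro exI[of _ "min (1 / 2) ((r ^ 3 / 128)\<^sup>2)"] conjI allI impI notI)
    show "0 < min (1 / 2) ((r ^ 3 / 128)\<^sup>2)" "min (1 / 2) ((r ^ 3 / 128)\<^sup>2) \<le> 1" using r by auto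
    fix \<alpha> assume \<alpha>: "0 < \<alpha> \<and> \<alpha> < min (1 / 2) ((r ^ 3 / 128)\<^sup>2)" and "A_plus c0 \<alpha> = A_minus c0 \<alpha>"
    then obtain \<sigma> x y z where "axial_tangent c0 \<alpha> \<sigma> x y z"
      using axial_tangent_if_A_plus_eq_A_minus[of c0 \<alpha>] c0 by auto
    then have le: "r ^ 3 / 96 \<le> sqrt \<alpha> / (sqrt (1 - \<alpha>\<^sup>2))\<^sup>2"
      using axial_tangent.damping_lower_bound r cr by blast
    have "\<alpha>\<^sup>2 \<le> (1 / 2)\<^sup>2" using \<alpha> by (intro power_mono) auto
    then have \<beta>: "3 / 4 \<le> (sqrt (1 - \<alpha>\<^sup>2))\<^sup>2" by (simp add: power2_eq_square)
    have "sqrt \<alpha> < r ^ 3 / 128" using \<alpha> r by (intro real_less_lsqrt) auto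
    moreover have "sqrt \<alpha> / (sqrt (1 - \<alpha>\<^sup>2))\<^sup>2 \<le> sqrt \<alpha> / (3 / 4)"
      using \<alpha> \<beta> by (intro divide_left_mono) auto
    ultimately show False using le by simp
  qed
next
  fix c0 :: real
  assume c0: "0 < c0 \<and> (\<forall>k::nat. c0 \<noteq> real k * sqrt pi)"
  have sin: "sin (c0 * sqrt pi) \<noteq> 0"
  proof
    assume "sin (c0 * sqrt pi) = 0"
    then obtain i :: int where i: "c0 * sqrt pi = of_int i * pi" by (auto simp: sin_zero_iff_int2)
    have "c0 * sqrt pi = (of_int i * sqrt pi) * sqrt pi" using i by simp
    then have i': "c0 = of_int i * sqrt pi" by simp
    then have "0 \<le> i" using c0 by (metis less_imp_le of_int_0_le_iff pi_gt_zero real_sqrt_gt_zero zero_less_mult_pos2)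
    then have "c0 = real (nat i) * sqrt pi" using i' by simp
    then show False using c0 by blast
  qed
  have "((\<lambda>\<alpha>. \<bar>sin (c0 * sqrt (pi / \<alpha>))\<bar> - 6 * sqrt (1 - \<alpha>\<^sup>2) * c0 / (\<alpha> * sqrt \<alpha>)) \<longlongrightarrow>
      \<bar>sin (c0 * sqrt (pi / 1))\<bar> - 6 * sqrt (1 - 1\<^sup>2) * c0 / (1 * sqrt 1)) (at_left 1)"
    by (intro tendsto_intros) auto
  then have "\<forall>\<^sub>F \<alpha> in at_left 1. 0 < \<bar>sin (c0 * sqrt (pi / \<alpha>))\<bar> - 6 * sqrt (1 - \<alpha>\<^sup>2) * c0 / (\<alpha> * sqrt \<alpha>)"
    using sin by (intro order_tendstoD(1)) auto
  then obtain a where a: "a < 1" "\<And>\<alpha>. a < \<alpha> \<Longrightarrow> \<alpha> < 1 \<Longrightarrow>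
      6 * sqrt (1 - \<alpha>\<^sup>2) * c0 / (\<alpha> * sqrt \<alpha>) < \<bar>sin (c0 * sqrt (pi / \<alpha>))\<bar>"
    by (auto simp: eventually_at_left_field)
  show "\<exists>\<alpha>1>0. 0 < 1 - \<alpha>1 \<and> (\<forall>\<alpha>. \<alpha>1 < \<alpha> \<and> \<alpha> < 1 \<longrightarrow> A_plus c0 \<alpha> \<noteq> A_minus c0 \<alpha>)"
  proof (intro exI[of _ "max a (1 / 2)"] conjI allI impI notI)
    show "0 < max a (1 / 2)" "0 < 1 - max a (1 / 2)" using a by auto
    fix \<alpha> assume \<alpha>: "max a (1 / 2) < \<alpha> \<and> \<alpha> < 1" and "A_plus c0 \<alpha> = A_minus c0 \<alpha>"
    then obtain \<sigma> x y z where "axial_tangent c0 \<alpha> \<sigma> x y z"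
      using axial_tangent_if_A_plus_eq_A_minus[of c0 \<alpha>] c0 by auto
    from axial_tangent.sin_total_curvature_bound[OF this] a(2)[of \<alpha>] \<alpha> show False by auto
  qed
qed

end
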